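(* Let $q=p^e>4$, where $p$ is a prime, and let $\ell$ be a positive integer with $2\ell\mid e$. Let $\boldsymbol a=(a_1,\ldots,a_n)$ be a vector listing (without repetition) the elements of one of the evaluation sets (R1)--(R10) described in the context, and let $k,h$ be integers satisfying the corresponding conditions, namely: - for (R1), (R3), (R5): $3\le k\le\left\lfloor\frac{n+p^\ell}{p^\ell+1}\right\rfloor$ and $0\le h\le k-3$; - for (R2), (R4), (R6), (R7), (R8), (R10): $3\le k\le\left\lfloor\frac{n+p^\ell-1}{p^\ell+1}\right\rfloor$ and $0\le h\le k-2$; - for (R9): either $3\le k\le\left\lfloor\frac{n+p^\ell}{p^\ell+1}\right\rfloor$ and $0\le h\le k-3$, or $3\le k\le\left\lfloor\frac{n+p^\ell-m}{p^\ell+1}\right\rfloor$ and $0\le h\le k-2$. Then there exists an $[n+2,k,n-k+2]_q$ NMDS generalized Roth-Lempel code $C$ with $\dim(\operatorname{Hull}_\ell(C))=h$. If $\Delta_{k-1}(\boldsymbol a)\ne\mathbb F_q$, there also exists an $[n+2,k,n-k+3]_q$ MDS generalized Roth-Lempel code $C$ with $\dim(\operatorname{Hull}_\ell(C))=h$. These two choices are obtained as codes $\operatorname{GRL}_k(\boldsymbol a,\boldsymbol v,A_\zeta)$, for suitable $\boldsymbol v\in(\mathbb F_q^* )^n$, by taking $A_\zeta=\begin{pmatrix}0&1\\1&\zeta\end{pmatrix}$ with $\zeta\in\Delta_{k-1}(\boldsymbol a)$ and $\zeta\in\mathbb F_q\setminus\Delta_{k-1}(\boldsymbol a)$, respecti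vely.
   Context: For $0\le\ell\le e-1$, the $\ell$-Galois inner product on $\mathbb F_q^N$ is $\langle\boldsymbol x,\boldsymbol y\rangle_\ell=\sum_i x_iy_i^{p^\ell}$; $C^{\perp_\ell}=\{\boldsymbol x:\langle\boldsymbol c,\boldsymbol x\rangle_\ell=0\ \forall\boldsymbol c\in C\}$ and $\operatorname{Hull}_\ell(C)=C\cap C^{\perp_\ell}$. An $[N,k,d]_q$ code is a $k$-dimensional subspace of $\mathbb F_q^N$ with minimum Hamming distance $d$; it is MDS if $d=N-k+1$, AMDS if $d=N-k$, and NMDS if both it and its Euclidean dual are AMDS. Generalized Roth-Lempel (GRL) code: for $1\le s\le k\le n$, $\boldsymbol a\in\mathbb F_q^n$ with distinct entries, $\boldsymbol v\in(\mathbb F_q^* )^n$, $A_s\in\operatorname{GL}_s(\mathbb F_q)$, $$\operatorname{GRL}_k(\boldsymbol a,\boldsymbol v,A_s)=\{(v_1f(a_1),\ldots,v_nf(a_n),(f_{k-s},\ldots,f_{k-1})A_s): f=\textstyle\sum_{j=0}^{k-1}f_jx^j\in\mathbb F_q[x]\},$$ an $[n+s,k]_q$ code. For $1\le t\le n$, $\Delta_t(\boldsymbol a)=\{\sum_{i\in I}a_i:I\subseteq\{1,\ldots,n\},|I|=t\}$. Evaluation sets ($n$ denotes the number of elements; $\omega$ is a primitive element of $\mathbb F_q$): (R1) $n=t\frac{q-1}{p^\ell-1}$, $1\le t\le p^\ell-1$: $\{x\in\mathbb F_q^*:x^{(q-1)/(p^\ell-1)}\in\{b_1,\ldots,b_t\}\}$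 for distinct $b_1,\ldots,b_t\in\mathbb F_{p^\ell}^*$. (R2) $n=t\frac{q-1}{p^\ell-1}+1$: a set (R1) together with $0$. (R3) $n=r_1r_2$: let $x_1,x_2$ be positive integers with $(q-1)\mid\operatorname{lcm}(x_1,x_2)$ and $\frac{q-1}{p^\ell-1}\mid x_1$, $\xi_1=\omega^{x_1}$, $\xi_2=\omega^{x_2}$, $r_2=\frac{q-1}{\gcd(x_2,q-1)}$, $1\le r_1\le\frac{q-1}{\gcd(x_1,q-1)}$; the set is $\{\xi_1^j\xi_2^v:1\le j\le r_1,1\le v\le r_2\}$. (R4) $n=r_1r_2+1$: a set (R3) together with $0$. (R5) $n=rm$: let $y=\frac{q-1}{p^\ell-1}$, $m\mid(q-1)$, $m_2=\gcd(m,y)$, $m_1=m/m_2$, $H=\langle\omega^{(q-1)/m}\rangle$, $G=\langle\omega^{y/m_2}\rangle$ (so $H\le G$ and $|G/H|=\frac{p^\ell-1}{m_1}$), $1\le r\le\frac{p^\ell-1}{m_1}$; the set is a union of $r$ distinct cosets of $H$ in $G$. (R6) $n=rm+1$: a set (R5) together with $0$. (R7) $n=tp^{e-\ell}$: let $B\subseteq\mathbb F_{p^\ell}$ be an $\mathbb F_p$-subspace, $1\le t\le|B|$, $b_1=0,b_2,\ldots,b_t\in B$ distinct; the set is $\{x\in\mathbb F_q:\operatorname{Tr}(x)\in\{b_1,\ldots,b_t\}\}$, where $\operatorname{Tr}(x)=x+x^{p^\ell}+\cdots+x^{p^{e-\ell}}$ is the trace $\mathbb F_q\to\mathbb F_{p^\ell}$.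 (R8) $n=tp^r$: let $V$ be an $r$-dimensional $\mathbb F_p$-subspace of $\mathbb F_q$, $L_V(x)=\prod_{v\in V}(x-v)$, and let $b_1,\ldots,b_t$ ($t\ge1$) be distinct elements of $L_V(\mathbb F_q)\cap\mathbb F_{p^\ell}$; the set is $\{x\in\mathbb F_q:L_V(x)\in\{b_1,\ldots,b_t\}\}$. (R9) $n=tmp^r$: let $V$ be an $r$-dimensional $\mathbb F_p$-subspace of $\mathbb F_{p^\ell}$, $0\le r<\ell$, $m\mid\frac{q-1}{p^\ell-1}$, $L_V(x)=\prod_{v\in V}(x-v)$, $\Phi(x)=L_V(x^m)$, and let $b_1,\ldots,b_t$ be distinct elements of $L_V(\mathbb F_{p^\ell})\setminus\{0\}$, $1\le t\le p^{\ell-r}-1$; the set is $\{x\in\mathbb F_q:\Phi(x)\in\{b_1,\ldots,b_t\}\}$. (R10) $n=1+m(tp^r-1)$: with $V,m,\Phi$ as in (R9), let $b_1=0,b_2,\ldots,b_t$ be distinct elements of $L_V(\mathbb F_{p^\ell})$, $1\le t\le p^{\ell-r}$; the set is $\{x\in\mathbb F_q:\Phi(x)\in\{b_1,\ldots,b_t\}\}$. *)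

theory Defs
  imports "Jordan_Normal_Form.VS_Connect" "HOL-Algebra.Subrings" "HOL-Library.Cardinality"
begin

text \<open>Throughout, the ambient field of \<open>q\<close> elements is a type \<open>'a :: {field, finite}\<close>,
  so that \<open>q = CARD('a)\<close>, and \<open>class_ring\<close> is the HOL-Algebra record of this field.\<close>

section \<open>Subfields and subspaces of the ambient field\<close>

text \<open>For \<open>q = p ^ e\<close> and \<open>l dvd e\<close> there is exactly one subfield with \<open>p ^ l\<close> elements.\<close>

definition subfield_of_card :: "nat \<Rightarrow> 'a :: {field, finite} set" where
  "subfield_of_card m = (THE K. subfield K class_ring \<and> card K = m)"

text \<open>The ambient field as a vector space over a subfield; the scalars are the elements of
  \<open>scalars K\<close>.\<close>

definition field_space :: "('a :: field, 'a) module" where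
  "field_space = \<lparr>carrier = UNIV, mult = undefined, one = undefined,
     zero = 0, add = (+), smult = (*)\<rparr>"

abbreviation scalars :: "'a :: field set \<Rightarrow> 'a ring" where
  "scalars K \<equiv> class_ring\<lparr>carrier := K\<rparr>"

definition subspace_over :: "'a :: field set \<Rightarrow> 'a set \<Rightarrow> bool" where
  "subspace_over K V \<longleftrightarrow> VectorSpace.subspace (scalars K) V field_space"

definition dim_over :: "'a :: field set \<Rightarrow> 'a set \<Rightarrow> nat" where
  "dim_over K V = vectorspace.dim (scalars K) (field_space\<lparr>carrier := V\<rparr>)"

definition primitive_element :: "'a :: field \<Rightarrow> bool" where
  "primitive_element \<omega> \<longleftrightarrow> \<omega> \<noteq> 0 \<and> (\<forall>x. x \<noteq> 0 \<longrightarrow> (\<exists>i::nat. x = \<omega> ^ i))"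

text \<open>Every element of the multiplicative group has finite order, so natural exponents suffice.\<close>

definition cyclic_subgroup :: "'a :: {field, finite} \<Rightarrow> 'a set" where
  "cyclic_subgroup g = range (\<lambda>i::nat. g ^ i)"


section \<open>Linear codes\<close>

definition hamming_dist :: "'a vec \<Rightarrow> 'a vec \<Rightarrow> nat" where
  "hamming_dist x y = card {i. i < dim_vec x \<and> x $ i \<noteq> y $ i}"

definition has_min_dist :: "'a vec set \<Rightarrow> nat \<Rightarrow> bool" where
  "has_min_dist C d \<longleftrightarrow>
     (\<exists>x\<in>C. \<exists>y\<in>C. x \<noteq> y \<and> hamming_dist x y = d) \<and>
     (\<forall>x\<in>C. \<forall>y\<in>C. x \<noteq> y \<longrightarrow> d \<le> hamming_dist x y)"

definition code_dim :: "nat \<Rightarrow> 'a :: field vec set \<Rightarrow> nat" where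
  "code_dim N C = vectorspace.dim class_ring ((module_vec TYPE('a) N)\<lparr>carrier := C\<rparr>)"

definition linear_code :: "nat \<Rightarrow> nat \<Rightarrow> nat \<Rightarrow> 'a :: field vec set \<Rightarrow> bool" where
  "linear_code N k d C \<longleftrightarrow>
     VectorSpace.subspace class_ring C (module_vec TYPE('a) N) \<and>
     code_dim N C = k \<and> has_min_dist C d"

definition galois_inner :: "nat \<Rightarrow> nat \<Rightarrow> 'a :: field vec \<Rightarrow> 'a vec \<Rightarrow> 'a" where
  "galois_inner p l x y = x \<bullet> map_vec (\<lambda>z. z ^ (p ^ l)) y"

definition galois_dual :: "nat \<Rightarrow> nat \<Rightarrow> nat \<Rightarrow> 'a :: field vec set \<Rightarrow> 'a vec set" where
  "galois_dual p l N C = {x \<in> carrier_vec N. \<forall>c\<in>C. galois_inner p l c x = 0}"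

definition galois_hull :: "nat \<Rightarrow> nat \<Rightarrow> nat \<Rightarrow> 'a :: field vec set \<Rightarrow> 'a vec set" where
  "galois_hull p l N C = C \<inter> galois_dual p l N C"

definition euclidean_dual :: "nat \<Rightarrow> 'a :: field vec set \<Rightarrow> 'a vec set" where
  "euclidean_dual N C = {x \<in> carrier_vec N. \<forall>c\<in>C. c \<bullet> x = 0}"

definition MDS :: "nat \<Rightarrow> 'a :: field vec set \<Rightarrow> bool" where
  "MDS N C \<longleftrightarrow> (\<exists>k d. linear_code N k d C \<and> d = N - k + 1)"

definition AMDS :: "nat \<Rightarrow> 'a :: field vec set \<Rightarrow> bool" where
  "AMDS N C \<longleftrightarrow> (\<exists>k d. linear_code N k d C \<and> d = N - k)"

definition NMDS :: "nat \<Rightarrow> 'a :: field vec set \<Rightarrow> bool" where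
  "NMDS N C \<longleftrightarrow> AMDS N C \<and> AMDS N (euclidean_dual N C)"


section \<open>Generalized Roth-Lempel codes\<close>

text \<open>Vectors are indexed from 0, and \<open>dim_vec a\<close> and \<open>dim_row A\<close> are the \<open>n\<close> and \<open>s\<close> of
  the code. The transpose turns the row vector times matrix product into \<open>(*\<^sub>v)\<close>.\<close>

definition GRL :: "nat \<Rightarrow> 'a :: field vec \<Rightarrow> 'a vec \<Rightarrow> 'a mat \<Rightarrow> 'a vec set" where
  "GRL k a v A =
     {vec (dim_vec a) (\<lambda>i. v $ i * poly f (a $ i)) @\<^sub>v
        (transpose_mat A *\<^sub>v vec (dim_row A) (\<lambda>j. Polynomial.coeff f (k - dim_row A + j))) | f.
      Polynomial.degree f < k}"

definition GRL_params ::
    "nat \<Rightarrow> nat \<Rightarrow> nat \<Rightarrow> 'a :: field vec \<Rightarrow> 'a vec \<Rightarrow> 'a mat \<Rightarrow> bool" where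
  "GRL_params n s k a v A \<longleftrightarrow>
     1 \<le> s \<and> s \<le> k \<and> k \<le> n \<and>
     a \<in> carrier_vec n \<and> distinct (list_of_vec a) \<and>
     v \<in> carrier_vec n \<and> (\<forall>i<n. v $ i \<noteq> 0) \<and>
     A \<in> carrier_mat s s \<and> invertible_mat A"

definition GRL_code :: "nat \<Rightarrow> nat \<Rightarrow> nat \<Rightarrow> 'a :: field vec set \<Rightarrow> bool" where
  "GRL_code n s k C \<longleftrightarrow> (\<exists>a v A. GRL_params n s k a v A \<and> C = GRL k a v A)"

definition Delta :: "nat \<Rightarrow> 'a :: field vec \<Rightarrow> 'a set" where
  "Delta t a = {\<Sum>i\<in>I. a $ i | I. I \<subseteq> {..<dim_vec a} \<and> card I = t}"

definition A_mat :: "'a :: field \<Rightarrow> 'a mat" where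
  "A_mat \<zeta> = mat_of_rows_list 2 [[0, 1], [1, \<zeta>]]"


section \<open>Evaluation sets\<close>

text \<open>The distinct values \<open>b\<^sub>1, \<dots>, b\<^sub>t\<close> are given as the set \<open>T\<close>, with \<open>t = card T\<close>.\<close>

definition evalset1 :: "nat \<Rightarrow> nat \<Rightarrow> 'a :: {field, finite} set \<Rightarrow> bool" where
  "evalset1 p l S \<longleftrightarrow>
     (\<exists>T. T \<subseteq> subfield_of_card (p ^ l) - {0} \<and> 1 \<le> card T \<and> card T \<le> p ^ l - 1 \<and>
          S = {x. x \<noteq> 0 \<and> x ^ ((CARD('a) - 1) div (p ^ l - 1)) \<in> T})"

definition evalset2 :: "nat \<Rightarrow> nat \<Rightarrow> 'a :: {field, finite} set \<Rightarrow> bool" where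
  "evalset2 p l S \<longleftrightarrow> (\<exists>S'. evalset1 p l S' \<and> S = insert 0 S')"

definition evalset3 :: "nat \<Rightarrow> nat \<Rightarrow> 'a :: {field, finite} \<Rightarrow> 'a set \<Rightarrow> bool" where
  "evalset3 p l \<omega> S \<longleftrightarrow>
     (\<exists>x\<^sub>1 x\<^sub>2 r\<^sub>1 r\<^sub>2 :: nat.
        0 < x\<^sub>1 \<and> 0 < x\<^sub>2 \<and> (CARD('a) - 1) dvd lcm x\<^sub>1 x\<^sub>2 \<and>
        ((CARD('a) - 1) div (p ^ l - 1)) dvd x\<^sub>1 \<and>
        r\<^sub>2 = (CARD('a) - 1) div gcd x\<^sub>2 (CARD('a) - 1) \<and>
        1 \<le> r\<^sub>1 \<and> r\<^sub>1 \<le> (CARD('a) - 1) div gcd x\<^sub>1 (CARD('a) - 1) \<and>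
        S = {(\<omega> ^ x\<^sub>1) ^ j * (\<omega> ^ x\<^sub>2) ^ v | j v. 1 \<le> j \<and> j \<le> r\<^sub>1 \<and> 1 \<le> v \<and> v \<le> r\<^sub>2})"

definition evalset4 :: "nat \<Rightarrow> nat \<Rightarrow> 'a :: {field, finite} \<Rightarrow> 'a set \<Rightarrow> bool" where
  "evalset4 p l \<omega> S \<longleftrightarrow> (\<exists>S'. evalset3 p l \<omega> S' \<and> S = insert 0 S')"

definition evalset5 :: "nat \<Rightarrow> nat \<Rightarrow> 'a :: {field, finite} \<Rightarrow> 'a set \<Rightarrow> bool" where
  "evalset5 p l \<omega> S \<longleftrightarrow>
     (\<exists>y m m\<^sub>1 m\<^sub>2 r :: nat. \<exists>H G. \<exists>\<C> :: 'a set set.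
        y = (CARD('a) - 1) div (p ^ l - 1) \<and> m dvd (CARD('a) - 1) \<and>
        m\<^sub>2 = gcd m y \<and> m\<^sub>1 = m div m\<^sub>2 \<and>
        H = cyclic_subgroup (\<omega> ^ ((CARD('a) - 1) div m)) \<and>
        G = cyclic_subgroup (\<omega> ^ (y div m\<^sub>2)) \<and>
        1 \<le> r \<and> r \<le> (p ^ l - 1) div m\<^sub>1 \<and>
        \<C> \<subseteq> (\<lambda>g. (*) g ` H) ` G \<and> card \<C> = r \<and>
        S = \<Union>\<C>)"

definition evalset6 :: "nat \<Rightarrow> nat \<Rightarrow> 'a :: {field, finite} \<Rightarrow> 'a set \<Rightarrow> bool" where
  "evalset6 p l \<omega> S \<longleftrightarrow> (\<exists>S'. evalset5 p l \<omega> S' \<and> S = insert 0 S')"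

definition rel_trace :: "nat \<Rightarrow> nat \<Rightarrow> nat \<Rightarrow> 'a :: field \<Rightarrow> 'a" where
  "rel_trace p e l x = (\<Sum>i<e div l. x ^ (p ^ (l * i)))"

definition evalset7 :: "nat \<Rightarrow> nat \<Rightarrow> nat \<Rightarrow> 'a :: {field, finite} set \<Rightarrow> bool" where
  "evalset7 p e l S \<longleftrightarrow>
     (\<exists>B T. B \<subseteq> subfield_of_card (p ^ l) \<and> subspace_over (subfield_of_card p) B \<and>
            T \<subseteq> B \<and> 0 \<in> T \<and> 1 \<le> card T \<and> card T \<le> card B \<and>
            S = {x. rel_trace p e l x \<in> T})"

definition subspace_poly :: "'a :: field set \<Rightarrow> 'a \<Rightarrow> 'a" where
  "subspace_poly V x = (\<Prod>v\<in>V. x - v)"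

definition evalset8 :: "nat \<Rightarrow> nat \<Rightarrow> 'a :: {field, finite} set \<Rightarrow> bool" where
  "evalset8 p l S \<longleftrightarrow>
     (\<exists>V r T. subspace_over (subfield_of_card p) V \<and> dim_over (subfield_of_card p) V = r \<and>
            T \<subseteq> range (subspace_poly V) \<inter> subfield_of_card (p ^ l) \<and> 1 \<le> card T \<and>
            S = {x. subspace_poly V x \<in> T})"

text \<open>The parameter \<open>m\<close> also enters the admissible range of \<open>k\<close>.\<close>

definition evalset9 :: "nat \<Rightarrow> nat \<Rightarrow> nat \<Rightarrow> 'a :: {field, finite} set \<Rightarrow> bool" where
  "evalset9 p l m S \<longleftrightarrow>
     (\<exists>V r T. V \<subseteq> subfield_of_card (p ^ l) \<and> subspace_over (subfield_of_card p) V \<and>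
            dim_over (subfield_of_card p) V = r \<and> r < l \<and>
            m dvd ((CARD('a) - 1) div (p ^ l - 1)) \<and>
            T \<subseteq> subspace_poly V ` subfield_of_card (p ^ l) - {0} \<and>
            1 \<le> card T \<and> card T \<le> p ^ (l - r) - 1 \<and>
            S = {x. subspace_poly V (x ^ m) \<in> T})"

definition evalset10 :: "nat \<Rightarrow> nat \<Rightarrow> 'a :: {field, finite} set \<Rightarrow> bool" where
  "evalset10 p l S \<longleftrightarrow>
     (\<exists>V r m T. V \<subseteq> subfield_of_card (p ^ l) \<and> subspace_over (subfield_of_card p) V \<and>
            dim_over (subfield_of_card p) V = r \<and> r < l \<and>
            m dvd ((CARD('a) - 1) div (p ^ l - 1)) \<and>
            T \<subseteq> subspace_poly V ` subfield_of_card (p ^ l) \<and> 0 \<in> T \<and>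
            1 \<le> card T \<and> card T \<le> p ^ (l - r) \<and>
            S = {x. subspace_poly V (x ^ m) \<in> T})"

end

theory Submission
  imports Defs "HOL-Number_Theory.Residues"
begin

text \<open>Let \<open>Q = p ^ l\<close>, let \<open>K\<close> be the subfield with \<open>Q\<close> elements, and for a node set \<open>S\<close> put
  \<open>D s = (\<Prod>t\<in>S - {s}. s - t)\<close>. Lagrange interpolation gives \<open>(\<Sum>s\<in>S. F s / D s) = 0\<close> whenever
  \<open>degree F \<le> card S - 2\<close>. Each evaluation set, possibly after adding or deleting \<open>0\<close>, is a full preimage
  under a polynomial with fibres of maximal size, so \<open>D s\<close> is a derivative that the chain rule places
  in \<open>K\<close> up to a common factor. For \<open>F = f * g ^ Q\<close> with \<open>degree f, degree g < k\<close> the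
  bound on \<open>k\<close> is exactly the required degree bound. As \<open>2 * l dvd e\<close>, elements of \<open>K\<close> are
  \<open>(Q + 1)\<close>-th powers, so \<open>v\<close> can be chosen to make the Galois form vanish on the evaluation
  part of the code, leaving only the two extra coordinates. Rescaling coordinates of \<open>v\<close> raises the
  rank of the form one by one, which realizes every hull dimension in the range.\<close>

section \<open>Lagrange interpolation sums\<close>

text \<open>For a power map \<open>x ^ m\<close> the chain rule leaves a factor
  \<open>s ^ (m - 1)\<close> that varies with \<open>s\<close> and need not lie in \<open>K\<close>;
  the different ranges of \<open>k\<close> and \<open>h\<close> reflect how it is removed. Adjoining
  \<open>0\<close> to the nodes multiplies \<open>D s\<close> by \<open>s\<close> and produces
  \<open>s ^ m\<close>, which is in \<open>K\<close>. If \<open>0\<close> is also a coordinate of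
  the code, nothing else changes; if not, its interpolation term stays in the Galois form and uses
  up one dimension for good, whence \<open>h \<le> k - 3\<close>, with one node gained.
  Alternatively \<open>s ^ (m - 1)\<close> is absorbed into \<open>F\<close>, which keeps
  \<open>h \<le> k - 2\<close> but costs \<open>m - 1\<close> in the degree bound: the second range
  for \<open>evalset9\<close>. For additive polynomials the derivative is a constant, which cancels
  from a vanishing sum. Whatever \<open>\<zeta>\<close> is, the two extra coordinates contribute
  rank two to the form. Hence a single \<open>v\<close> serves all \<open>\<zeta>\<close>, and
  \<open>\<zeta>\<close> only decides between the two minimum distances, through Vieta's
  formula.\<close>

definition root_poly :: "'a :: field set \<Rightarrow> 'a poly" where
  "root_poly S = (\<Prod>s\<in>S. [:-s, 1:])"

definition node_prod :: "'a :: field set \<Rightarrow> 'a \<Rightarrow> 'a" where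
  "node_prod S s = (\<Prod>t\<in>S - {s}. s - t)"

lemma poly_root_poly: "poly (root_poly S) x = (\<Prod>s\<in>S. x - s)"
  by (simp add: root_poly_def poly_prod)

lemma poly_root_poly_eq_0_iff: "finite S \<Longrightarrow> poly (root_poly S) x = 0 \<longleftrightarrow> x \<in> S"
  by (auto simp: poly_root_poly)

lemma root_poly_neq_0: "root_poly S \<noteq> 0"
  by (cases "finite S") (auto simp: root_poly_def)

lemma degree_root_poly: "Polynomial.degree (root_poly S) = card S"
  unfolding root_poly_def
  by (cases "finite S") (auto simp: degree_prod_eq_sum_degree)

lemma lead_coeff_root_poly: "Polynomial.coeff (root_poly S) (card S) = 1"
proof -
  have "lead_coeff (root_poly S) = 1"
    by (simp add: root_poly_def lead_coeff_prod)
  then show ?thesis by (simp add: degree_root_poly)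
qed

text \<open>Vieta's formula. This coefficient is what brings the subset sums of \<open>Delta\<close>
  into play, both for the code and for its dual.\<close>

lemma second_coeff_root_poly:
  assumes "finite S" "S \<noteq> {}"
  shows "Polynomial.coeff (root_poly S) (card S - 1) = - \<Sum>S"
  using assms
proof (induction S rule: finite_ne_induct)
  case (singleton x)
  then show ?case by (simp add: root_poly_def)
next
  case (insert x F)
  have "root_poly (insert x F) = [:-x, 1:] * root_poly F"
    using insert by (simp add: root_poly_def)
  then have eq: "root_poly (insert x F) = Polynomial.smult (-x) (root_poly F) + pCons 0 (root_poly F)"
    by simp
  obtain m where m: "card F = Suc m"
    using insert by (metis card_0_eq not0_implies_Suc)
  have "Polynomial.coeff (root_poly (insert x F)) (Suc m) = - x - \<Sum>F"
    using insert.IH lead_coeff_root_poly[of F] by (simp add: eq m del: smult_minus_left)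
  then show ?case using insert m by simp
qed

lemma node_prod_neq_0: "finite S \<Longrightarrow> node_prod S s \<noteq> 0"
  by (auto simp: node_prod_def)

lemma node_prod_insert:
  assumes "finite S" "x \<notin> S" "s \<in> S"
  shows "node_prod (insert x S) s = (s - x) * node_prod S s"
proof -
  have "insert x S - {s} = insert x (S - {s})" using assms by auto
  then show ?thesis using assms by (simp add: node_prod_def)
qed

lemma node_prod_insert_new:
  assumes "x \<notin> S"
  shows "node_prod (insert x S) x = poly (root_poly S) x"
  using assms by (simp add: node_prod_def poly_root_poly)

lemma poly_root_poly_remove:
  assumes "finite S" "s \<in> S" "t \<in> S"
  shows "poly (root_poly (S - {s})) t = (if s = t then node_prod S s else 0)"
  using assms by (auto simp: node_prod_def poly_root_poly)

text \<open>The degree bound is put on the difference so that two monic polynomials of degree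
  \<open>card S\<close> also qualify.\<close>

lemma poly_eq_if_agree:
  fixes f g :: "'a :: field poly"
  assumes "finite S" "\<And>x. x \<in> S \<Longrightarrow> poly f x = poly g x"
    and "Polynomial.degree (f - g) < card S"
  shows "f = g"
proof (rule ccontr)
  assume "f \<noteq> g"
  then have ne: "f - g \<noteq> 0" by simp
  have "card S \<le> card {x. poly (f - g) x = 0}"
    using assms poly_roots_finite[OF ne] by (intro card_mono) auto
  also have "\<dots> \<le> Polynomial.degree (f - g)"
    using ne by (rule card_poly_roots_bound)
  finally show False using assms by simp
qed

lemma lagrange_interpolation:
  fixes f :: "'a :: field poly"
  assumes "finite S" "Polynomial.degree f < card S"
  shows "f = (\<Sum>s\<in>S. Polynomial.smult (poly f s / node_prod S s) (root_poly (S - {s})))"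
    (is "f = ?L")
proof (rule poly_eq_if_agree[OF assms(1)])
  fix x assume x: "x \<in> S"
  have "poly ?L x = (\<Sum>s\<in>S. if s = x then poly f x else 0)"
    unfolding poly_sum using assms x node_prod_neq_0[of S]
    by (intro sum.cong) (auto simp: poly_root_poly_remove)
  then show "poly f x = poly ?L x" using x assms by simp
next
  have "Polynomial.degree ?L \<le> card S - 1"
    by (intro degree_sum_le) (use assms in \<open>auto simp: degree_root_poly\<close>)
  then show "Polynomial.degree (f - ?L) < card S"
    using assms degree_diff_le[of f "card S - 1" ?L] by linarith
qed

text \<open>Compare the coefficients of \<open>x ^ (card S - 1)\<close> in Lagrange's formula: every
  \<open>root_poly (S - {s})\<close> is monic of exactly that degree.\<close>

lemma sum_over_node_prod_coeff:
  fixes f :: "'a :: field poly"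
  assumes "finite S" "Polynomial.degree f < card S"
  shows "(\<Sum>s\<in>S. poly f s / node_prod S s) = Polynomial.coeff f (card S - 1)"
proof -
  have "Polynomial.coeff f (card S - 1) = (\<Sum>s\<in>S. Polynomial.coeff
      (Polynomial.smult (poly f s / node_prod S s) (root_poly (S - {s}))) (card S - 1))"
    by (subst lagrange_interpolation[OF assms]) (rule coeff_sum)
  also have "\<dots> = (\<Sum>s\<in>S. poly f s / node_prod S s)"
  proof (intro sum.cong refl)
    fix s assume "s \<in> S"
    then show "Polynomial.coeff (Polynomial.smult (poly f s / node_prod S s) (root_poly (S - {s})))
      (card S - 1) = poly f s / node_prod S s"
      using lead_coeff_root_poly[of "S - {s}"] assms by simp
  qed
  finally show ?thesis ..
qed

lemma root_poly_dvd:
  assumes "finite S" "\<And>s. s \<in> S \<Longrightarrow> poly f s = 0"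
  shows "root_poly S dvd f"
  using assms
proof (induction S rule: finite_induct)
  case empty
  then show ?case by (simp add: root_poly_def)
next
  case (insert x F)
  then obtain g where g: "f = root_poly F * g" by (auto elim: dvdE)
  have "poly g x = 0"
    using insert.prems[of x] insert.hyps g poly_root_poly_eq_0_iff[of F x] by simp
  then have "[:-x, 1:] dvd g" by (simp add: poly_eq_0_iff_dvd)
  moreover have "root_poly (insert x F) = [:-x, 1:] * root_poly F"
    unfolding root_poly_def using insert(1,2) by (rule prod.insert)
  ultimately show ?case
    using mult_dvd_mono[OF _ dvd_refl[of "root_poly F"]] by (simp only: g mult.commute[of _ g])
qed

lemma sum_over_node_prod_eq_0:
  assumes "finite S" "Polynomial.degree f + 1 < card S"
  shows "(\<Sum>s\<in>S. poly f s / node_prod S s) = 0"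
  using assms by (subst sum_over_node_prod_coeff) (auto intro: coeff_eq_0)

text \<open>Subtracting a multiple of \<open>root_poly S\<close> cancels the top coefficient without
  changing any value on \<open>S\<close>; by Vieta it shifts the next coefficient by a multiple of
  \<open>\<Sum>S\<close>. The right-hand side has the shape of the last code coordinate with
  \<open>\<zeta> = \<Sum>S\<close>, which later yields a dual codeword.\<close>

lemma sum_over_node_prod_degree_le_card:
  assumes "finite S" "S \<noteq> {}" "Polynomial.degree f \<le> card S"
  shows "(\<Sum>s\<in>S. poly f s / node_prod S s) =
    Polynomial.coeff f (card S - 1) + Polynomial.coeff f (card S) * \<Sum>S"
proof -
  define c where "c = Polynomial.coeff f (card S)"
  define g where "g = f - Polynomial.smult c (root_poly S)"
  have pos: "card S > 0" using assms by auto
  have "Polynomial.degree g \<le> card S"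
    unfolding g_def using assms by (intro degree_diff_le) (auto simp: degree_root_poly)
  moreover have "Polynomial.coeff g (card S) = 0"
    by (simp add: g_def c_def lead_coeff_root_poly)
  ultimately have deg: "Polynomial.degree g < card S"
    using pos by (metis degree_0 eq_zero_or_degree_less)
  have "(\<Sum>s\<in>S. poly f s / node_prod S s) = (\<Sum>s\<in>S. poly g s / node_prod S s)"
    using assms poly_root_poly_eq_0_iff[OF assms(1)] by (intro sum.cong) (auto simp: g_def)
  also have "\<dots> = Polynomial.coeff g (card S - 1)"
    using assms(1) deg by (rule sum_over_node_prod_coeff)
  also have "\<dots> = Polynomial.coeff f (card S - 1) + c * \<Sum>S"
    using assms using second_coeff_root_poly[OF assms(1,2)] by (simp add: g_def)
  finally show ?thesis by (simp add: c_def)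
qed

text \<open>By the product rule, since all summands but one vanish at \<open>s\<close>. It is the
  gateway to computing node products by the chain rule.\<close>

lemma node_prod_eq_pderiv_root_poly:
  assumes "finite S" "s \<in> S"
  shows "node_prod S s = poly (pderiv (root_poly S)) s"
proof -
  have "poly (pderiv (root_poly S)) s = (\<Sum>t\<in>S. poly (root_poly (S - {t})) s)"
    by (simp add: root_poly_def pderiv_prod poly_sum pderiv_pCons)
  also have "\<dots> = (\<Sum>t\<in>S. if t = s then node_prod S s else 0)"
    using assms by (intro sum.cong) (auto simp: poly_root_poly_remove)
  finally show ?thesis using assms by simp
qed

lemma monic_eq_root_poly:
  assumes "finite S" "lead_coeff F = 1" "Polynomial.degree F = card S"
    and "\<And>x. x \<in> S \<Longrightarrow> poly F x = 0"
  shows "F = root_poly S"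
proof (cases "card S = 0")
  case True
  then have "S = {}" using assms by simp
  then show ?thesis using assms True by (auto simp: root_poly_def elim!: degree_eq_zeroE)
next
  case False
  show ?thesis
  proof (rule poly_eq_if_agree[OF assms(1)])
    show "poly F x = poly (root_poly S) x" if "x \<in> S" for x
      using that assms by (simp add: poly_root_poly_eq_0_iff)
    have "Polynomial.degree (F - root_poly S) \<le> card S"
      using assms by (intro degree_diff_le) (auto simp: degree_root_poly)
    moreover have "Polynomial.coeff (F - root_poly S) (card S) = 0"
      using assms by (simp add: lead_coeff_root_poly)
    ultimately show "Polynomial.degree (F - root_poly S) < card S"
      using False by (metis degree_0 eq_zero_or_degree_less gr0I)
  qed
qed

text \<open>If the full preimage of \<open>T\<close> under a monic polynomial \<open>G\<close> has the maximal size
  \<open>card T * degree G\<close>, then \<open>(\<Prod>b\<in>T. G - b)\<close> is its root polynomial, so the product of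
  differences is a derivative and factors by the chain rule.\<close>

lemma
  fixes G :: "'a :: {field, finite} poly"
  assumes "lead_coeff G = 1" "Polynomial.degree G > 0"
    and fibres: "\<And>b. b \<in> T \<Longrightarrow> card {x. poly G x = b} = Polynomial.degree G"
  defines "S \<equiv> {x. poly G x \<in> T}"
  shows root_poly_preimage: "root_poly S = (\<Prod>b\<in>T. G - [:b:])"
    and node_prod_preimage:
      "s \<in> S \<Longrightarrow> node_prod S s = poly (pderiv G) s * (\<Prod>b\<in>T - {poly G s}. poly G s - b)"
proof -
  have [simp]: "finite T" "finite S" by auto
  have deg: "Polynomial.degree (G - [:b:]) = Polynomial.degree G" for b
    using assms(2) by (metis degree_add_eq_left degree_minus degree_pCons_0 diff_conv_add_uminus)
  have lc: "lead_coeff (G - [:b:]) = 1" for b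
    unfolding deg using assms(1,2) by (simp add: coeff_pCons split: nat.split)
  have ne: "G - [:b:] \<noteq> 0" for b
    using lc[of b] by (metis leading_coeff_0_iff zero_neq_one)
  have "card S = (\<Sum>b\<in>T. card {x. poly G x = b})"
    unfolding S_def
    by (subst card_UN_disjoint[symmetric]) (auto intro!: arg_cong[of _ _ card])
  also have "\<dots> = card T * Polynomial.degree G"
    using fibres by simp
  finally have card_S: "card S = card T * Polynomial.degree G" .
  show root: "root_poly S = (\<Prod>b\<in>T. G - [:b:])"
  proof (rule monic_eq_root_poly[symmetric])
    show "lead_coeff (\<Prod>b\<in>T. G - [:b:]) = 1"
      by (simp add: lead_coeff_prod lc del: coeff_diff)
    show "Polynomial.degree (\<Prod>b\<in>T. G - [:b:]) = card S"
      by (subst degree_prod_eq_sum_degree) (use assms(2) in \<open>auto simp: deg card_S\<close>)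
  qed (auto simp: S_def poly_prod)
  show "node_prod S s = poly (pderiv G) s * (\<Prod>b\<in>T - {poly G s}. poly G s - b)" if "s \<in> S"
  proof -
    have "node_prod S s = (\<Sum>b\<in>T. (\<Prod>c\<in>T - {b}. poly G s - c) * poly (pderiv G) s)"
      using that by (simp add: node_prod_eq_pderiv_root_poly root pderiv_prod poly_sum poly_prod
          pderiv_diff pderiv_pCons)
    also have "\<dots> = (\<Sum>b\<in>T. if b = poly G s
        then (\<Prod>c\<in>T - {poly G s}. poly G s - c) * poly (pderiv G) s else 0)"
    proof (intro sum.cong refl)
      fix b assume "b \<in> T"
      show "(\<Prod>c\<in>T - {b}. poly G s - c) * poly (pderiv G) s = (if b = poly G s
        then (\<Prod>c\<in>T - {poly G s}. poly G s - c) * poly (pderiv G) s else 0)"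
        using that by (auto simp: S_def)
    qed
    finally show ?thesis using that by (simp add: S_def mult.commute)
  qed
qed

section \<open>The multiplicative group and the subfields of a finite field\<close>

text \<open>Multiplication by \<open>x\<close> permutes \<open>G\<close>, so the product over
  \<open>G\<close> absorbs \<open>x ^ card G\<close>. Stated for any stable set, it covers the units
  of the whole field as well as those of an arbitrary subfield.\<close>

lemma power_card_eq_1:
  fixes x :: "'a :: field"
  assumes "finite G" "0 \<notin> G" "x \<noteq> 0" "\<And>g. g \<in> G \<Longrightarrow> x * g \<in> G"
  shows "x ^ card G = 1"
proof -
  have inj: "inj_on ((*) x) G" using assms(3) by (auto intro: inj_onI)
  have "(*) x ` G = G"
    using assms inj by (intro card_subset_eq) (auto simp: card_image)
  then have "\<Prod>G = (\<Prod>g\<in>G. x * g)"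
    using inj by (metis prod.reindex_cong)
  also have "\<dots> = x ^ card G * \<Prod>G"
    by (simp add: prod.distrib)
  finally show ?thesis using assms(1,2) by simp
qed

lemma power_CARD_minus_1:
  fixes x :: "'a :: {field, finite}"
  assumes "x \<noteq> 0"
  shows "x ^ (CARD('a) - 1) = 1"
proof -
  have "x ^ card (UNIV - {0 :: 'a}) = 1"
    using assms by (intro power_card_eq_1) auto
  then show ?thesis by (simp add: card_Diff_singleton)
qed

context
  fixes \<omega> :: "'a :: {field, finite}"
  assumes primitive: "primitive_element \<omega>"
begin

lemma primitive_element_neq_0: "\<omega> \<noteq> 0"
  using primitive by (simp add: primitive_element_def)

lemma CARD_minus_1_pos: "CARD('a) - 1 > 0"
proof -
  have "card {0, 1 :: 'a} \<le> CARD('a)" by (intro card_mono) auto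
  then show ?thesis by simp
qed

lemma primitive_element_power_mod: "\<omega> ^ (i mod (CARD('a) - 1)) = \<omega> ^ i"
proof -
  have "\<omega> ^ i = \<omega> ^ ((CARD('a) - 1) * (i div (CARD('a) - 1)) + i mod (CARD('a) - 1))" by simp
  also have "\<dots> = \<omega> ^ (i mod (CARD('a) - 1))"
    unfolding power_add power_mult
    using power_CARD_minus_1[OF primitive_element_neq_0] by simp
  finally show ?thesis by simp
qed

lemma nonzero_eq_primitive_power:
  assumes "x \<noteq> 0"
  obtains i where "i < CARD('a) - 1" "x = \<omega> ^ i"
proof -
  obtain j where "x = \<omega> ^ j" using assms primitive by (auto simp: primitive_element_def)
  then show ?thesis
    using that[of "j mod (CARD('a) - 1)"] CARD_minus_1_pos
    by (simp add: primitive_element_power_mod del: One_nat_def)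
qed

lemma inj_on_primitive_power: "inj_on (\<lambda>i. \<omega> ^ i) {..<CARD('a) - 1}"
proof (rule eq_card_imp_inj_on)
  have "(\<lambda>i. \<omega> ^ i) ` {..<CARD('a) - 1} = UNIV - {0}"
  proof
    show "(\<lambda>i. \<omega> ^ i) ` {..<CARD('a) - 1} \<subseteq> UNIV - {0}"
      using primitive_element_neq_0 by auto
    show "UNIV - {0} \<subseteq> (\<lambda>i. \<omega> ^ i) ` {..<CARD('a) - 1}"
    proof
      fix x :: 'a assume "x \<in> UNIV - {0}"
      then obtain i where "i < CARD('a) - 1" "x = \<omega> ^ i"
        using nonzero_eq_primitive_power[of x] by blast
      then show "x \<in> (\<lambda>i. \<omega> ^ i) ` {..<CARD('a) - 1}" by blast
    qed
  qed
  then show "card ((\<lambda>i. \<omega> ^ i) ` {..<CARD('a) - 1}) = card {..<CARD('a) - 1}"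
    by (simp add: card_Diff_singleton)
qed simp

lemma primitive_power_eq_1_iff: "\<omega> ^ i = 1 \<longleftrightarrow> (CARD('a) - 1) dvd i"
proof
  assume "\<omega> ^ i = 1"
  then have "\<omega> ^ (i mod (CARD('a) - 1)) = \<omega> ^ 0"
    by (simp add: primitive_element_power_mod del: One_nat_def)
  moreover have "i mod (CARD('a) - 1) \<in> {..<CARD('a) - 1}" "0 \<in> {..<CARD('a) - 1}"
    using CARD_minus_1_pos by auto
  ultimately have "i mod (CARD('a) - 1) = 0"
    using inj_on_primitive_power by (meson inj_onD)
  then show "(CARD('a) - 1) dvd i" by presburger
next
  assume "(CARD('a) - 1) dvd i"
  then show "\<omega> ^ i = 1"
    using power_CARD_minus_1[OF primitive_element_neq_0] by (auto simp: power_mult)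
qed

lemma roots_of_unity_eq:
  assumes "CARD('a) - 1 = m * y"
  shows "{x :: 'a. x ^ m = 1} = (\<lambda>j. \<omega> ^ (y * j)) ` {..<m}"
proof
  have pos: "m > 0" "y > 0" using assms CARD_minus_1_pos by auto
  show "(\<lambda>j. \<omega> ^ (y * j)) ` {..<m} \<subseteq> {x. x ^ m = 1}"
    by (auto simp: primitive_power_eq_1_iff assms simp del: One_nat_def simp flip: power_mult)
  show "{x. x ^ m = 1} \<subseteq> (\<lambda>j. \<omega> ^ (y * j)) ` {..<m}"
  proof
    fix x :: 'a assume x: "x \<in> {x. x ^ m = 1}"
    then have "x \<noteq> 0" using pos by (auto simp: power_0_left)
    then obtain i where i: "i < CARD('a) - 1" "x = \<omega> ^ i"
      using nonzero_eq_primitive_power by blast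
    then have "\<omega> ^ (i * m) = 1" using x by (simp add: power_mult)
    then have "m * y dvd i * m" by (simp add: primitive_power_eq_1_iff assms del: One_nat_def)
    then have "m * y dvd m * i" by (simp only: mult.commute)
    then have "y dvd i" using pos by simp
    then obtain j where j: "i = y * j" by blast
    then have "j < m" using i assms pos by (simp add: mult.commute)
    then show "x \<in> (\<lambda>j. \<omega> ^ (y * j)) ` {..<m}" using i j by auto
  qed
qed

lemma card_roots_of_unity:
  assumes "m dvd CARD('a) - 1"
  shows "card {x :: 'a. x ^ m = 1} = m"
proof -
  obtain y where y: "CARD('a) - 1 = m * y" using assms by blast
  have pos: "y > 0" using y CARD_minus_1_pos by auto
  have "inj_on (\<lambda>j. \<omega> ^ (y * j)) {..<m}"
  proof (rule inj_onI)
    fix i j assume "i \<in> {..<m}" "j \<in> {..<m}" "\<omega> ^ (y * i) = \<omega> ^ (y * j)"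
    then have "y * i = y * j"
      using y pos by (intro inj_onD[OF inj_on_primitive_power]) (auto simp: mult.commute)
    then show "i = j" using pos by simp
  qed
  then show ?thesis by (simp add: roots_of_unity_eq[OF y] card_image)
qed

text \<open>The fibre is a coset of the \<open>m\<close>-th roots of unity, so power maps have
  fibres of maximal size over their nonzero values.\<close>

lemma card_power_fibre:
  fixes c :: 'a
  assumes "m dvd CARD('a) - 1" "c \<noteq> 0"
  shows "card {x. x ^ m = c ^ m} = m"
proof -
  have "{x. x ^ m = c ^ m} = (*) c ` {x. x ^ m = 1}"
  proof (intro equalityI subsetI)
    fix x assume "x \<in> {x. x ^ m = c ^ m}"
    then have "x = c * (x / c)" "(x / c) ^ m = 1"
      using assms(2) by (auto simp: power_divide)
    then show "x \<in> (*) c ` {x. x ^ m = 1}" by blast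
  qed (auto simp: power_mult_distrib)
  moreover have "inj_on ((*) c) {x. x ^ m = 1}" using assms(2) by (auto intro: inj_onI)
  ultimately show ?thesis
    using card_roots_of_unity[OF assms(1)] by (simp add: card_image)
qed

lemma root_of_unity_is_power:
  fixes x :: 'a
  assumes "CARD('a) - 1 = m * y" "x ^ m = 1"
  obtains z where "z \<noteq> 0" "x = z ^ y"
proof -
  have "x \<in> (\<lambda>j. \<omega> ^ (y * j)) ` {..<m}"
    using assms roots_of_unity_eq by blast
  then obtain j where "x = (\<omega> ^ j) ^ y"
    by (auto simp: mult.commute simp flip: power_mult)
  then show ?thesis using that primitive_element_neq_0 by (metis power_not_zero)
qed

end

section \<open>Subfields as fixed points of powers of the Frobenius map\<close>

definition fixed_field :: "nat \<Rightarrow> 'a :: field set" where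
  "fixed_field m = {x. x ^ m = x}"

lemma minus_1_dvd_power_minus_1: "(x - 1 :: nat) dvd x ^ d - 1"
proof (cases "x = 0")
  case False
  have "int (x - 1) dvd int (x ^ d - 1)"
    using False power_diff_1_eq[of "int x" d] by (simp add: of_nat_diff)
  then show ?thesis by presburger
qed (cases d; simp)

locale finite_field_tower =
  fixes p e l :: nat and \<omega> :: "'a :: {field, finite}"
  assumes prime_p: "prime p" and CARD_eq: "CARD('a) = p ^ e"
    and l_pos: "0 < l" and l_dvd: "l dvd e" and primitive: "primitive_element \<omega>"
begin

abbreviation "K \<equiv> fixed_field (p ^ l) :: 'a set"

lemma p_gt_1: "p > 1" using prime_p prime_gt_1_nat by blast

lemma pl_gt_1: "p ^ l > 1" using p_gt_1 l_pos by (intro one_less_power)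

lemma CHAR_eq: "CHAR('a) = p"
proof -
  have "prime CHAR('a)"
    by (rule prime_CHAR_semidom) (use finite_imp_CHAR_pos[where ?'a = 'a] in simp)
  moreover have "CHAR('a) dvd p ^ e"
    using CHAR_dvd_CARD[where ?'a = 'a] by (simp add: CARD_eq)
  ultimately show ?thesis
    using prime_p prime_dvd_power primes_dvd_imp_eq by blast
qed

lemma add_power_p_power: "(x + y :: 'a) ^ (p ^ i) = x ^ (p ^ i) + y ^ (p ^ i)"
  using freshmans_dream'[where ?'a = 'a, of "p ^ i" i] prime_p CHAR_eq by simp

lemma sum_power_p_power: "(sum f A :: 'a) ^ (p ^ i) = (\<Sum>x\<in>A. f x ^ (p ^ i))"
  using freshmans_dream_sum'[where ?'a = 'a, of "p ^ i" i] prime_p CHAR_eq by simp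

lemma dvd_CARD: "p ^ l - 1 dvd CARD('a) - 1"
  using l_dvd minus_1_dvd_power_minus_1[of "p ^ l"]
  by (auto simp: CARD_eq power_mult elim!: dvdE)

lemma zero_in_K: "0 \<in> K" and one_in_K: "1 \<in> K"
  using p_gt_1 by (auto simp: fixed_field_def power_0_left)

lemma add_in_K: "x \<in> K \<Longrightarrow> y \<in> K \<Longrightarrow> x + y \<in> K"
  by (simp add: fixed_field_def add_power_p_power)

lemma mult_in_K: "x \<in> K \<Longrightarrow> y \<in> K \<Longrightarrow> x * y \<in> K"
  by (simp add: fixed_field_def power_mult_distrib)

lemma uminus_in_K: "x \<in> K \<Longrightarrow> - x \<in> K"
proof -
  assume "x \<in> K"
  \<comment> \<open>Additivity of Frobenius settles the sign for even and odd characteristic at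
    once.\<close>
  moreover have "x ^ (p ^ l) + (- x) ^ (p ^ l) = 0"
    using add_power_p_power[of x "-x" l] p_gt_1 by (simp add: power_0_left)
  ultimately show ?thesis by (simp add: fixed_field_def eq_neg_iff_add_eq_0 add.commute)
qed

lemma diff_in_K: "x \<in> K \<Longrightarrow> y \<in> K \<Longrightarrow> x - y \<in> K"
  using add_in_K[of x "-y"] uminus_in_K by simp

lemma inverse_in_K: "x \<in> K \<Longrightarrow> inverse x \<in> K"
  by (simp add: fixed_field_def power_inverse)

lemma divide_in_K: "x \<in> K \<Longrightarrow> y \<in> K \<Longrightarrow> x / y \<in> K"
  by (simp add: divide_inverse mult_in_K inverse_in_K)

lemma power_in_K: "x \<in> K \<Longrightarrow> x ^ i \<in> K"
  by (induction i) (auto simp: one_in_K mult_in_K)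

lemma prod_in_K: "(\<And>i. i \<in> A \<Longrightarrow> f i \<in> K) \<Longrightarrow> prod f A \<in> K"
  by (induction A rule: infinite_finite_induct) (auto simp: one_in_K mult_in_K)

lemma of_nat_in_K: "of_nat i \<in> K"
  by (induction i) (auto simp: zero_in_K one_in_K add_in_K)

lemma nonzero_in_K_iff: "x \<noteq> 0 \<Longrightarrow> x \<in> K \<longleftrightarrow> x ^ (p ^ l - 1) = 1"
proof -
  assume "x \<noteq> 0"
  moreover have "x ^ (p ^ l) = x ^ (p ^ l - 1) * x"
    using p_gt_1 by (subst power_minus_mult) simp_all
  ultimately show ?thesis by (simp add: fixed_field_def)
qed

lemma card_K: "card K = p ^ l"
proof -
  have "K = insert 0 {x. x ^ (p ^ l - 1) = 1}"
  proof (intro Set.set_eqI)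
    fix x :: 'a
    show "x \<in> K \<longleftrightarrow> x \<in> insert 0 {x. x ^ (p ^ l - 1) = 1}"
      by (cases "x = 0") (simp_all add: zero_in_K nonzero_in_K_iff)
  qed
  moreover have "(0 :: 'a) \<notin> {x. x ^ (p ^ l - 1) = 1}"
    using pl_gt_1 by (simp add: power_0_left)
  ultimately have "card K = Suc (p ^ l - 1)"
    using card_roots_of_unity[OF primitive dvd_CARD] by simp
  then show ?thesis using pl_gt_1 by simp
qed

lemma subfield_K: "subfield K class_ring"
proof (rule field.subfieldI'[OF class_field])
  have "ring (class_ring :: 'a ring)"
    by unfold_locales
  then show "subring K class_ring"
    by (rule ring.subringI)
      (auto simp: class_ring_simps one_in_K mult_in_K add_in_K uminus_in_K)
qed (auto simp: class_ring_simps inverse_in_K)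

text \<open>The units of any subfield \<open>L\<close> of this size satisfy
  \<open>x ^ (p ^ l - 1) = 1\<close>, so \<open>L\<close> lies in \<open>K\<close> and equals it by
  cardinality; this is the uniqueness that the definite description demands.\<close>

lemma subfield_of_card_eq: "subfield_of_card (p ^ l) = K"
  unfolding subfield_of_card_def
proof (rule the_equality)
  show "subfield K class_ring \<and> card K = p ^ l"
    using subfield_K card_K by simp
  fix L :: "'a set" assume L: "subfield L class_ring \<and> card L = p ^ l"
  then interpret L: subfield L class_ring by simp
  have mult: "x * y \<in> L" if "x \<in> L" "y \<in> L" for x y
    using L.m_closed that by simp
  have zero: "0 \<in> L" using subringE(2)[OF L.subring_axioms] by simp
  have "L \<subseteq> K"
  proof
    fix x assume x: "x \<in> L"
    have "x ^ card (L - {0}) = 1" if "x \<noteq> 0"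
      using that x mult by (intro power_card_eq_1) auto
    then show "x \<in> K"
      using nonzero_in_K_iff[of x] zero_in_K L zero
      by (cases "x = 0") (auto simp: card_Diff_singleton)
  qed
  then show "L = K" using L card_K by (intro card_subset_eq) auto
qed

text \<open>The units of \<open>K\<close> are the \<open>(p ^ l - 1)\<close>-th roots of unity,
  hence powers whose exponent is the index of this group, hence \<open>m\<close>-th powers for every
  divisor \<open>m\<close> of the index. Used both for fibres of \<open>x ^ m\<close> and, with
  \<open>m = p ^ l + 1\<close>, to extract the column multipliers.\<close>

lemma K_nonzero_is_power:
  assumes "x \<in> K" "x \<noteq> 0" "m dvd (CARD('a) - 1) div (p ^ l - 1)"
  obtains z where "z \<noteq> 0" "x = z ^ m"
proof -
  obtain j where j: "(CARD('a) - 1) div (p ^ l - 1) = m * j" using assms(3) by blast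
  have "x ^ (p ^ l - 1) = 1" using assms nonzero_in_K_iff by blast
  moreover have "CARD('a) - 1 = (p ^ l - 1) * (m * j)"
    unfolding j[symmetric] by (rule dvd_mult_div_cancel[OF dvd_CARD, symmetric])
  ultimately obtain z where z: "z \<noteq> 0" "x = z ^ (m * j)"
    by (elim root_of_unity_is_power[OF primitive, rotated])
  show ?thesis
    using z by (intro that[of "z ^ j"]) (auto simp: mult.commute simp flip: power_mult)
qed

lemma primitive_power_in_K:
  assumes "(CARD('a) - 1) div (p ^ l - 1) dvd i"
  shows "\<omega> ^ i \<in> K"
proof -
  have "CARD('a) - 1 dvd i * (p ^ l - 1)"
    using mult_dvd_mono[OF assms dvd_refl[of "p ^ l - 1"]] by (simp only: dvd_div_mult_self[OF dvd_CARD])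
  then have "(\<omega> ^ i) ^ (p ^ l - 1) = 1"
    by (simp only: primitive_power_eq_1_iff[OF primitive] flip: power_mult)
  then show ?thesis
    using nonzero_in_K_iff primitive_element_neq_0[OF primitive] by simp
qed

end

section \<open>Additive subgroups and their root polynomials\<close>

lemma subspace_over_zero_and_add:
  assumes "subspace_over F V"
  shows "0 \<in> V" "\<And>x y. x \<in> V \<Longrightarrow> y \<in> V \<Longrightarrow> x + y \<in> V"
proof -
  interpret V: subspace "scalars F" V "field_space"
    using assms by (simp add: subspace_over_def)
  interpret V: submodule "scalars F" V "field_space"
    by (rule V.submod)
  show "0 \<in> V" using V.zero_closed by (simp add: field_space_def)
  show "x + y \<in> V" if "x \<in> V" "y \<in> V" for x y
    using V.m_closed[OF that] by (simp add: field_space_def)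
qed

context
  fixes V :: "'a :: {field, finite} set"
  assumes zero: "0 \<in> V" and add: "\<And>x y. x \<in> V \<Longrightarrow> y \<in> V \<Longrightarrow> x + y \<in> V"
begin

lemma translate_additive_subgroup: "v \<in> V \<Longrightarrow> (+) v ` V = V"
  using add by (intro card_subset_eq) (auto simp: card_image)

lemma poly_root_poly_translate:
  assumes "v \<in> V"
  shows "poly (root_poly V) (c + v) = poly (root_poly V) c"
proof -
  have "(\<Prod>u\<in>V. c + v - u) = (\<Prod>u\<in>(+) v ` V. c + v - u)"
    using assms translate_additive_subgroup by simp
  also have "\<dots> = (\<Prod>u\<in>V. c - u)"
    by (subst prod.reindex) auto
  finally show ?thesis by (simp add: poly_root_poly)
qed

text \<open>Invariance under translation puts the whole coset into the fibre, and the degree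
  \<open>card V\<close> leaves no room for further points.\<close>

lemma root_poly_fibre: "{x. poly (root_poly V) x = poly (root_poly V) c} = (+) c ` V"
proof (rule sym, rule card_seteq)
  define F where "F = root_poly V - [:poly (root_poly V) c:]"
  have "card V > 0" using zero by (auto simp: card_gt_0_iff)
  then have deg: "Polynomial.degree F = card V"
    unfolding F_def using degree_root_poly[of V]
    by (metis degree_add_eq_left degree_minus degree_pCons_0 diff_conv_add_uminus)
  have "F \<noteq> 0" using deg \<open>card V > 0\<close> by auto
  then have "card {x. poly F x = 0} \<le> card V"
    using card_poly_roots_bound[of F] deg by simp
  then show "card {x. poly (root_poly V) x = poly (root_poly V) c} \<le> card ((+) c ` V)"
    by (simp add: F_def card_image)
qed (auto simp: poly_root_poly_translate)

lemma card_root_poly_fibre: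
  "card {x. poly (root_poly V) x = poly (root_poly V) c} = Polynomial.degree (root_poly V)"
  by (simp add: root_poly_fibre card_image degree_root_poly)

text \<open>Linearized polynomials have constant derivative. No coefficients are needed: translation
  gives the derivative the same value at all \<open>card V\<close> points of \<open>V\<close>, and
  its degree is smaller than \<open>card V\<close>.\<close>

lemma pderiv_root_poly_additive: "pderiv (root_poly V) = [:node_prod V 0:]"
proof (rule poly_eq_if_agree[of V])
  fix v assume v: "v \<in> V"
  have "V - {v} = (+) v ` (V - {0})"
    using translate_additive_subgroup[OF v] by (auto simp: image_set_diff)
  then have "node_prod V v = (\<Prod>t\<in>(+) v ` (V - {0}). v - t)"
    by (simp add: node_prod_def)
  also have "\<dots> = node_prod V 0"
    unfolding node_prod_def by (subst prod.reindex) auto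
  finally show "poly (pderiv (root_poly V)) v = poly [:node_prod V 0:] v"
    using v by (simp add: node_prod_eq_pderiv_root_poly[symmetric])
next
  have "card V > 0" using zero by (auto simp: card_gt_0_iff)
  moreover have "Polynomial.degree (pderiv (root_poly V)) \<le> card V - 1"
    by (rule degree_le) (auto simp: coeff_pderiv degree_root_poly intro!: coeff_eq_0)
  ultimately show "Polynomial.degree (pderiv (root_poly V) - [:node_prod V 0:]) < card V"
    using degree_diff_le[of "pderiv (root_poly V)" "card V - 1" "[:node_prod V 0:]"]
    by (simp add: degree_root_poly)
qed simp

end

section \<open>Evaluation sets whose node products lie in the subfield\<close>

context finite_field_tower
begin

text \<open>The common shape of \<open>evalset1\<close>, \<open>evalset3\<close>,
  \<open>evalset5\<close> and \<open>evalset9\<close>, and of the remaining multiplicative sets once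
  \<open>0\<close> is deleted. Requiring each \<open>w\<close> to be an \<open>m\<close>-th power
  makes every fibre have exactly \<open>m\<close> points.\<close>

definition power_preimage :: "nat \<Rightarrow> 'a set \<Rightarrow> bool" where
  "power_preimage m S \<longleftrightarrow> m dvd CARD('a) - 1 \<and>
     (\<exists>W \<subseteq> K - {0}. (\<forall>w\<in>W. \<exists>z. w = z ^ m) \<and> S = {x. x ^ m \<in> W})"

lemma power_preimage_pos: "power_preimage m S \<Longrightarrow> m > 0"
  using CARD_minus_1_pos[OF primitive] dvd_pos_nat unfolding power_preimage_def by blast

lemma zero_notin_power_preimage: "power_preimage m S \<Longrightarrow> 0 \<notin> S"
  using power_preimage_pos[of m S] unfolding power_preimage_def by (auto simp: power_0_left)

text \<open>The chain rule gives \<open>of_nat m * s ^ (m - 1)\<close> times a product of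
  differences in \<open>K\<close>. The first claim cancels the power of \<open>s\<close>; in the
  second, the extra node \<open>0\<close> completes it to \<open>s ^ m\<close>, an element of
  \<open>W\<close>.\<close>

lemma power_preimage_node_prod:
  assumes "power_preimage m S"
  shows "s \<in> S \<Longrightarrow> s ^ (m - 1) / node_prod S s \<in> K"
    and "s \<in> insert 0 S \<Longrightarrow> node_prod (insert 0 S) s \<in> K"
proof -
  obtain W where W: "W \<subseteq> K - {0}" "\<And>w. w \<in> W \<Longrightarrow> \<exists>z. w = z ^ m" and S: "S = {x. x ^ m \<in> W}"
    and m: "m dvd CARD('a) - 1"
    using assms unfolding power_preimage_def by blast
  note [simp] = power_preimage_pos[OF assms]
  define G :: "'a poly" where "G = Polynomial.monom 1 m"
  have G: "lead_coeff G = 1" "Polynomial.degree G = m" "poly G x = x ^ m" for x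
    by (auto simp: G_def degree_monom_eq poly_monom)
  have fibres: "card {x. poly G x = b} = Polynomial.degree G" if b: "b \<in> W" for b
  proof -
    obtain z where z: "b = z ^ m" using W(2)[OF b] by blast
    have "z \<noteq> 0" using z b W(1) by auto
    then show ?thesis using card_power_fibre[OF primitive m] by (simp add: G z)
  qed
  have S': "S = {x. poly G x \<in> W}" by (simp add: S G)
  have np: "node_prod S s = of_nat m * s ^ (m - 1) * (\<Prod>b\<in>W - {s ^ m}. s ^ m - b)"
    if "s \<in> S" for s
    using node_prod_preimage[of G W s] that G fibres
    unfolding S'[symmetric] by (simp add: G_def pderiv_monom poly_monom)
  have prod_in: "(\<Prod>b\<in>W - {s ^ m}. s ^ m - b) \<in> K" if "s \<in> S" for s
    using that W by (intro prod_in_K diff_in_K) (auto simp: S)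
  have nz: "s \<noteq> 0" if "s \<in> S" for s using that zero_notin_power_preimage[OF assms] by auto
  show "s ^ (m - 1) / node_prod S s \<in> K" if "s \<in> S"
  proof -
    have "s ^ (m - 1) / node_prod S s = 1 / (of_nat m * (\<Prod>b\<in>W - {s ^ m}. s ^ m - b))"
      using nz[OF that] by (simp add: np[OF that])
    then show ?thesis
      using prod_in[OF that] by (metis divide_in_K mult_in_K of_nat_in_K one_in_K)
  qed
  show "node_prod (insert 0 S) s \<in> K" if "s \<in> insert 0 S"
  proof (cases "s = 0")
    case True
    \<comment> \<open>At the new node the product is the value of \<open>root_poly S\<close> at
      \<open>0\<close>, which is a product of elements \<open>- b\<close> of
      \<open>K\<close>.\<close>
    have "root_poly S = (\<Prod>b\<in>W. G - [:b:])"
      unfolding S' by (rule root_poly_preimage) (use G fibres in auto)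
    then have "node_prod (insert 0 S) s = (\<Prod>b\<in>W. - b)"
      using True zero_notin_power_preimage[OF assms]
      by (simp add: node_prod_insert_new poly_prod G zero_power)
    then show ?thesis using W by (auto intro!: prod_in_K uminus_in_K)
  next
    case False
    then have s: "s \<in> S" using that by simp
    have "s * s ^ (m - 1) = s ^ m"
      using power_preimage_pos[OF assms] power_minus_mult[of m s] by (simp add: mult.commute)
    then have "node_prod (insert 0 S) s = of_nat m * s ^ m * (\<Prod>b\<in>W - {s ^ m}. s ^ m - b)"
      using s zero_notin_power_preimage[OF assms]
      by (simp add: node_prod_insert np mult.left_commute)
    then show ?thesis
      using prod_in[OF s] s W by (auto simp: S intro!: mult_in_K of_nat_in_K)
  qed
qed

section \<open>Evaluation sets that are preimages under a power map, up to the point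
  \<open>0\<close>\<close>

lemma index_dvd_CARD_minus_1: "(CARD('a) - 1) div (p ^ l - 1) dvd CARD('a) - 1"
  by (rule div_dvd_iff_mult[THEN iffD2]) (use dvd_CARD pl_gt_1 in auto)

lemma evalset1_power_preimage:
  assumes "evalset1 p l S"
  obtains m where "power_preimage m S"
proof -
  define y where "y = (CARD('a) - 1) div (p ^ l - 1)"
  obtain T where T: "T \<subseteq> K - {0}" and S: "S = {x. x \<noteq> 0 \<and> x ^ y \<in> T}"
    using assms unfolding evalset1_def y_def subfield_of_card_eq by blast
  have y: "y dvd CARD('a) - 1" using index_dvd_CARD_minus_1 by (simp add: y_def)
  then have "y > 0" using CARD_minus_1_pos[OF primitive] dvd_pos_nat by blast
  then have "S = {x. x ^ y \<in> T}"
    using T by (auto simp: S power_0_left)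
  moreover have "\<exists>z. w = z ^ y" if "w \<in> T" for w
    by (rule K_nonzero_is_power[of w y]) (use that T in \<open>auto simp: y_def\<close>)
  ultimately show ?thesis
    using that[of y] y T unfolding power_preimage_def by blast
qed

text \<open>Here \<open>m\<close> is the order of \<open>\<omega> ^ x2\<close>, so the powers of
  that element are all the \<open>m\<close>-th roots of unity and \<open>S\<close> is a union of
  their cosets. The map \<open>x ^ m\<close> collapses each coset to a power of
  \<open>\<omega> ^ x1\<close>, which lies in \<open>K\<close> because the index of the units of
  \<open>K\<close> divides \<open>x1\<close>.\<close>

lemma evalset3_power_preimage:
  assumes "evalset3 p l \<omega> S"
  obtains m where "power_preimage m S"
proof -
  obtain x1 x2 r1 m where x1: "(CARD('a) - 1) div (p ^ l - 1) dvd x1"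
    and m: "m = (CARD('a) - 1) div gcd x2 (CARD('a) - 1)"
    and S: "S = {(\<omega> ^ x1) ^ j * (\<omega> ^ x2) ^ v | j v. 1 \<le> j \<and> j \<le> r1 \<and> 1 \<le> v \<and> v \<le> m}"
    using assms unfolding evalset3_def by blast
  define g where "g = gcd x2 (CARD('a) - 1)"
  have q: "CARD('a) - 1 = m * g" by (simp add: m g_def)
  have pos: "m > 0" "g > 0" using q CARD_minus_1_pos[OF primitive] by auto
  obtain x where x: "x2 = g * x" unfolding g_def by (meson dvdE gcd_dvd1)
  have cop: "coprime x m"
  proof -
    have "gcd (g * x) (g * m) = g" 
      unfolding mult.commute[of g m] q[symmetric] x[symmetric] by (rule g_def[symmetric])
    then have "g * gcd x m = g * 1" by (simp add: gcd_mult_distrib_nat)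
    then show ?thesis using pos by (simp add: coprime_iff_gcd_eq_1)
  qed
  define W where "W = (\<lambda>j. (\<omega> ^ x1) ^ (j * m)) ` {1..r1}"
  have roots: "(\<lambda>v. (\<omega> ^ x2) ^ v) ` {1..m} = {x. x ^ m = 1}"
  proof (rule card_subset_eq)
    show "(\<lambda>v. (\<omega> ^ x2) ^ v) ` {1..m} \<subseteq> {x. x ^ m = 1}"
    proof
      fix z assume "z \<in> (\<lambda>v. (\<omega> ^ x2) ^ v) ` {1..m}"
      then obtain v where "z = \<omega> ^ (x2 * v)" by (auto simp: power_mult)
      then have "z ^ m = \<omega> ^ ((m * g) * (x * v))" by (simp add: x ac_simps flip: power_mult)
      also have "\<dots> = 1" by (simp add: primitive_power_eq_1_iff[OF primitive] q del: One_nat_def)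
      finally show "z \<in> {x. x ^ m = 1}" by simp
    qed
    have "inj_on (\<lambda>v. (\<omega> ^ x2) ^ v) {1..m}"
    proof (rule linorder_inj_onI)
      fix u v assume uv: "u < v" "u \<in> {1..m}" "v \<in> {1..m}"
      show "(\<omega> ^ x2) ^ u \<noteq> (\<omega> ^ x2) ^ v"
      proof
        assume eq: "(\<omega> ^ x2) ^ u = (\<omega> ^ x2) ^ v"
        have "(\<omega> ^ x2) ^ v = (\<omega> ^ x2) ^ u * (\<omega> ^ x2) ^ (v - u)"
          using uv by (simp flip: power_add)
        then have "\<omega> ^ (x2 * (v - u)) = 1"
          using eq primitive_element_neq_0[OF primitive] by (simp add: power_mult)
        then have "g * m dvd g * (x * (v - u))"
          using q x by (simp add: primitive_power_eq_1_iff[OF primitive] ac_simps del: One_nat_def)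
        then have "m dvd x * (v - u)" using pos by simp
        then have "m dvd v - u" using cop by (simp add: coprime_commute coprime_dvd_mult_right_iff)
        then show False using uv by (auto dest: dvd_imp_le)
      qed
    qed auto
    then show "card ((\<lambda>v. (\<omega> ^ x2) ^ v) ` {1..m}) = card {x :: 'a. x ^ m = 1}"
      using card_roots_of_unity[OF primitive, of m] q by (simp add: card_image)
  qed simp
  have "S = {x. x ^ m \<in> W}"
  proof (intro equalityI subsetI)
    fix z assume "z \<in> S"
    then obtain j v where jv: "z = (\<omega> ^ x1) ^ j * (\<omega> ^ x2) ^ v" "j \<in> {1..r1}" "v \<in> {1..m}"
      unfolding S by auto
    then have "((\<omega> ^ x2) ^ v) ^ m = 1" using roots by blast
    then have "z ^ m = (\<omega> ^ x1) ^ (j * m)" by (simp add: jv power_mult_distrib power_mult)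
    then show "z \<in> {x. x ^ m \<in> W}" using jv by (auto simp: W_def)
  next
    fix z assume "z \<in> {x. x ^ m \<in> W}"
    then obtain j where j: "j \<in> {1..r1}" "z ^ m = (\<omega> ^ x1) ^ (j * m)" by (auto simp: W_def)
    have nz: "(\<omega> ^ x1) ^ j \<noteq> 0" using primitive_element_neq_0[OF primitive] by simp
    then have "(z / (\<omega> ^ x1) ^ j) ^ m = 1"
      using j by (simp add: power_divide power_mult)
    then obtain v where "v \<in> {1..m}" "z / (\<omega> ^ x1) ^ j = (\<omega> ^ x2) ^ v"
      using roots by blast
    then show "z \<in> S" using j nz unfolding S by (auto simp: field_simps)
  qed
  moreover have "W \<subseteq> K - {0}"
    using primitive_power_in_K[OF x1] primitive_element_neq_0[OF primitive]
    by (auto simp: W_def power_in_K)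
  moreover have "\<exists>z. w = z ^ m" if "w \<in> W" for w
    using that by (auto simp: W_def power_mult)
  ultimately show ?thesis
    using that[of m] dvd_triv_left[of m g] unfolding power_preimage_def q by blast
qed

text \<open>\<open>H\<close> is the group of \<open>m\<close>-th roots of unity, so its cosets are
  the fibres of \<open>x ^ m\<close>, and the \<open>m\<close>-th powers of elements of
  \<open>G\<close> fall into \<open>K\<close>.\<close>

lemma evalset5_power_preimage:
  assumes "evalset5 p l \<omega> S"
  obtains m where "power_preimage m S"
proof -
  obtain y m m1 m2 H G \<C> where y: "y = (CARD('a) - 1) div (p ^ l - 1)"
    and m: "m dvd CARD('a) - 1" and m2: "m2 = gcd m y"
    and H: "H = cyclic_subgroup (\<omega> ^ ((CARD('a) - 1) div m))"
    and G: "G = cyclic_subgroup (\<omega> ^ (y div m2))"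
    and \<C>: "\<C> \<subseteq> (\<lambda>g. (*) g ` H) ` G" and S: "S = \<Union>\<C>"
    using assms unfolding evalset5_def by blast
  define y' where "y' = (CARD('a) - 1) div m"
  have q: "CARD('a) - 1 = m * y'" using m by (simp add: y'_def)
  have H_eq: "H = {x. x ^ m = 1}"
  proof
    show "H \<subseteq> {x. x ^ m = 1}"
    proof
      fix z assume "z \<in> H"
      then obtain i where "z = \<omega> ^ (y' * i)"
        by (auto simp: H cyclic_subgroup_def y'_def power_mult)
      then have "z ^ m = \<omega> ^ ((m * y') * i)" by (simp add: ac_simps flip: power_mult)
      also have "\<dots> = 1" by (simp add: primitive_power_eq_1_iff[OF primitive] q del: One_nat_def)
      finally show "z \<in> {x. x ^ m = 1}" by simp
    qed
    show "{x. x ^ m = 1} \<subseteq> H"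
      unfolding roots_of_unity_eq[OF primitive q] H cyclic_subgroup_def y'_def[symmetric]
      by (auto simp: power_mult)
  qed
  have G_nz: "g \<noteq> 0" if "g \<in> G" for g
    using that primitive_element_neq_0[OF primitive] by (auto simp: G cyclic_subgroup_def)
  have G_K: "g ^ m \<in> K" if "g \<in> G" for g
  proof -
    obtain i where i: "g = \<omega> ^ ((y div m2) * i)"
      using \<open>g \<in> G\<close> by (auto simp: G cyclic_subgroup_def power_mult)
    have "m2 dvd y" "m2 dvd m" by (auto simp: m2)
    then obtain y2 m1 where "y = m2 * y2" "m = m2 * m1" by (auto elim!: dvdE)
    \<comment> \<open>Since \<open>m2\<close> divides both numbers, \<open>(y div m2) * m\<close>
      equals \<open>y * m1\<close>.\<close>
    then have "y dvd (y div m2) * i * m" by (cases "m2 = 0") auto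
    then have "\<omega> ^ ((y div m2) * i * m) \<in> K"
      unfolding y by (rule primitive_power_in_K)
    then show ?thesis by (simp add: i power_mult)
  qed
  have coset: "(*) g ` H = {x. x ^ m = g ^ m}" if "g \<in> G" for g
  proof (intro equalityI subsetI)
    fix x assume "x \<in> {x. x ^ m = g ^ m}"
    then have "x = g * (x / g)" "(x / g) ^ m = 1"
      using G_nz[OF that] by (auto simp: power_divide)
    then show "x \<in> (*) g ` H" unfolding H_eq by blast
  qed (auto simp: H_eq power_mult_distrib)
  define W where "W = {g ^ m | g. g \<in> G \<and> (*) g ` H \<in> \<C>}"
  have "S = {x. x ^ m \<in> W}"
  proof (intro equalityI subsetI)
    fix x assume "x \<in> S"
    then obtain C where C: "C \<in> \<C>" "x \<in> C" by (auto simp: S)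
    then obtain g where "g \<in> G" "C = (*) g ` H" using \<C> by blast
    then show "x \<in> {x. x ^ m \<in> W}" using C coset by (auto simp: W_def)
  next
    fix x assume "x \<in> {x. x ^ m \<in> W}"
    then obtain g where "g \<in> G" "(*) g ` H \<in> \<C>" "x ^ m = g ^ m" by (auto simp: W_def)
    then show "x \<in> S" using coset by (auto simp: S)
  qed
  moreover have "W \<subseteq> K - {0}" using G_K G_nz by (auto simp: W_def)
  moreover have "\<exists>z. w = z ^ m" if "w \<in> W" for w using that by (auto simp: W_def)
  ultimately show ?thesis
    using that[of m] m unfolding power_preimage_def by blast
qed

text \<open>The additive layer dissolves: as \<open>V\<close> lies in \<open>K\<close> and
  \<open>T\<close> consists of values taken on \<open>K\<close>, each fibre of
  \<open>subspace_poly V\<close> over \<open>T\<close> is a coset of \<open>V\<close> inside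
  \<open>K\<close>. What remains is a condition on \<open>x ^ m\<close> alone. Deleting
  \<open>0\<close> lets one statement serve both \<open>evalset9\<close> and
  \<open>evalset10\<close>.\<close>

lemma subspace_poly_power_preimage:
  assumes V: "V \<subseteq> K" "0 \<in> V" "\<And>x y. x \<in> V \<Longrightarrow> y \<in> V \<Longrightarrow> x + y \<in> V"
    and m: "m dvd (CARD('a) - 1) div (p ^ l - 1)"
    and T: "T \<subseteq> subspace_poly V ` K"
  shows "power_preimage m ({x. subspace_poly V (x ^ m) \<in> T} - {0})"
proof -
  have sp: "subspace_poly V x = poly (root_poly V) x" for x
    by (simp add: subspace_poly_def poly_root_poly)
  have mq: "m dvd CARD('a) - 1" using m index_dvd_CARD_minus_1 by (rule dvd_trans)
  then have "m > 0" using CARD_minus_1_pos[OF primitive] dvd_pos_nat by blast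
  define W where "W = {z. subspace_poly V z \<in> T} - {0}"
  have "W \<subseteq> K - {0}"
  proof
    fix z assume z: "z \<in> W"
    then obtain c where c: "c \<in> K" "poly (root_poly V) z = poly (root_poly V) c"
      using T by (auto simp: W_def sp)
    then have "z \<in> (+) c ` V" using root_poly_fibre[OF V(2,3), of c] by blast
    then show "z \<in> K - {0}" using z c V(1) add_in_K by (auto simp: W_def)
  qed
  moreover have "\<exists>z. w = z ^ m" if "w \<in> W" for w
    by (rule K_nonzero_is_power[OF _ _ m, of w]) (use that calculation in auto)
  moreover have "{x. subspace_poly V (x ^ m) \<in> T} - {0} = {x. x ^ m \<in> W}"
    using \<open>m > 0\<close> by (auto simp: W_def power_0_left)
  ultimately show ?thesis
    using mq unfolding power_preimage_def by blast
qed

lemma evalset9_power_preimage: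
  assumes "evalset9 p l m S"
  shows "power_preimage m S"
proof -
  obtain V r T where V: "V \<subseteq> K" "subspace_over (subfield_of_card p) V"
    and m: "m dvd (CARD('a) - 1) div (p ^ l - 1)"
    and T: "T \<subseteq> subspace_poly V ` K - {0}" and S: "S = {x. subspace_poly V (x ^ m) \<in> T}"
    using assms unfolding evalset9_def subfield_of_card_eq by blast
  have "m > 0"
    using m index_dvd_CARD_minus_1 CARD_minus_1_pos[OF primitive] by (meson dvd_pos_nat dvd_trans)
  note VV = subspace_over_zero_and_add[OF V(2)]
  have "subspace_poly V 0 = 0" using VV(1) by (auto simp: subspace_poly_def)
  then have "0 \<notin> S" using T \<open>m > 0\<close> by (auto simp: S power_0_left)
  then show ?thesis
    using subspace_poly_power_preimage[OF V(1) VV m, of T] T by (simp add: S subset_iff)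
qed

lemma evalset10_power_preimage:
  assumes "evalset10 p l S"
  obtains m S' where "power_preimage m S'" "S = insert 0 S'"
proof -
  obtain V r m T where V: "V \<subseteq> K" "subspace_over (subfield_of_card p) V"
    and m: "m dvd (CARD('a) - 1) div (p ^ l - 1)"
    and T: "T \<subseteq> subspace_poly V ` K" "0 \<in> T" and S: "S = {x. subspace_poly V (x ^ m) \<in> T}"
    using assms unfolding evalset10_def subfield_of_card_eq by blast
  have "m > 0"
    using m index_dvd_CARD_minus_1 CARD_minus_1_pos[OF primitive] by (meson dvd_pos_nat dvd_trans)
  note VV = subspace_over_zero_and_add[OF V(2)]
  have "subspace_poly V 0 = 0" using VV(1) by (auto simp: subspace_poly_def)
  then have "0 \<in> S" using T \<open>m > 0\<close> by (auto simp: S power_0_left)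
  then show ?thesis
    using that[of m "S - {0}"] subspace_poly_power_preimage[OF V(1) VV m T(1)] by (auto simp: S)
qed

section \<open>Evaluation sets cut out by additive polynomials\<close>

lemma evalset8_node_prod:
  assumes "evalset8 p l S"
  obtains \<mu> where "\<mu> \<noteq> 0" "\<And>s. s \<in> S \<Longrightarrow> \<mu> / node_prod S s \<in> K"
proof -
  obtain V T where V: "subspace_over (subfield_of_card p) V"
    and T: "T \<subseteq> range (subspace_poly V) \<inter> K" and S: "S = {x. subspace_poly V x \<in> T}"
    using assms unfolding evalset8_def subfield_of_card_eq by blast
  note VV = subspace_over_zero_and_add[OF V]
  have sp: "subspace_poly V x = poly (root_poly V) x" for x
    by (simp add: subspace_poly_def poly_root_poly)
  \<comment> \<open>The constant derivative of the subspace polynomial. It need not lie in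
    \<open>K\<close>, so it is scaled away.\<close>
  define \<mu> where "\<mu> = node_prod V 0"
  have "card V > 0" using VV(1) by (auto simp: card_gt_0_iff)
  have fib: "card {x. poly (root_poly V) x = b} = Polynomial.degree (root_poly V)" if "b \<in> T" for b
    using that T card_root_poly_fibre[OF VV] by (auto simp: sp)
  have "\<mu> / node_prod S s \<in> K" if s: "s \<in> S" for s
  proof -
    have "node_prod S s = \<mu> * (\<Prod>b\<in>T - {subspace_poly V s}. subspace_poly V s - b)"
      using node_prod_preimage[of "root_poly V" T s] fib \<open>card V > 0\<close> s
      by (simp add: degree_root_poly lead_coeff_root_poly pderiv_root_poly_additive[OF VV] \<mu>_def S sp)
    then have "\<mu> / node_prod S s = 1 / (\<Prod>b\<in>T - {subspace_poly V s}. subspace_poly V s - b)"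
      using node_prod_neq_0[of V 0] by (simp add: \<mu>_def)
    moreover have "(\<Prod>b\<in>T - {subspace_poly V s}. subspace_poly V s - b) \<in> K"
      using s T by (intro prod_in_K diff_in_K) (auto simp: S)
    ultimately show ?thesis by (simp add: divide_in_K one_in_K)
  qed
  then show ?thesis using that[of \<mu>] node_prod_neq_0[of V 0] by (simp add: \<mu>_def)
qed

text \<open>The trace maps the \<open>Q ^ Suc d\<close> field elements into the \<open>Q\<close>
  elements of \<open>K\<close>, and its degree bounds each fibre by \<open>Q ^ d\<close>; so every
  fibre attains the bound.\<close>

lemma
  assumes "e > 0" "b \<in> K"
  shows card_rel_trace_fibre: "card {x. rel_trace p e l x = b} = (p ^ l) ^ (e div l - 1)"
    and rel_trace_monic_poly: "\<exists>G. (\<forall>x :: 'a. poly G x = rel_trace p e l x) \<and> lead_coeff G = 1 \<and>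
      Polynomial.degree G = (p ^ l) ^ (e div l - 1) \<and> pderiv G = 1"
proof -
  define Q where "Q = p ^ l"
  obtain d where d: "e = l * Suc d" using l_dvd assms(1) by (metis dvdE mult_0_right not0_implies_Suc less_numeral_extra(3))
  have e_div: "e div l = Suc d" using d l_pos by simp
  have q: "CARD('a) = Q ^ Suc d" by (simp only: CARD_eq d Q_def power_mult)
  define G :: "'a poly" where "G = (\<Sum>i<Suc d. Polynomial.monom 1 (Q ^ i))"
  have Q: "Q > 1" using pl_gt_1 by (simp add: Q_def)
  have pG: "poly G x = rel_trace p e l x" for x
    by (simp add: G_def poly_sum poly_monom rel_trace_def e_div Q_def power_mult)
  have cG: "Polynomial.coeff G n = (\<Sum>i<Suc d. if Q ^ i = n then 1 else 0)" for n
    by (simp add: G_def coeff_sum)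
  have "Polynomial.coeff G (Q ^ d) = (\<Sum>i<Suc d. if i = d then 1 else 0)"
    unfolding cG using Q by (intro sum.cong) (auto simp: power_inject_exp)
  then have lc: "Polynomial.coeff G (Q ^ d) = 1" by simp
  have "Polynomial.degree G \<le> Q ^ d"
  proof (rule degree_le, intro allI impI)
    fix n assume "Q ^ d < n"
    moreover have "Q ^ i \<le> Q ^ d" if "i < Suc d" for i
      using that Q by (intro power_increasing) auto
    ultimately show "Polynomial.coeff G n = 0"
      unfolding cG by (intro sum.neutral) force
  qed
  moreover have "Q ^ d \<le> Polynomial.degree G" using lc by (intro le_degree) simp
  ultimately have dG: "Polynomial.degree G = Q ^ d" by simp
  \<comment> \<open>All exponents except \<open>Q ^ 0\<close> are divisible by the characteristic,
    so only the linear term survives differentiation.\<close>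
  have p0: "(of_nat (Q ^ i) :: 'a) = (if i = 0 then 1 else 0)" for i
    using l_pos by (auto simp: of_nat_eq_0_iff_char_dvd CHAR_eq Q_def simp flip: power_mult)
  have "pderiv G = (\<Sum>i<Suc d. pderiv (Polynomial.monom 1 (Q ^ i)))"
    using higher_pderiv_sum[of 1 "\<lambda>i. Polynomial.monom 1 (Q ^ i)" "{..<Suc d}"]
    by (simp add: G_def)
  also have "\<dots> = (\<Sum>i<Suc d. if i = 0 then 1 else 0)"
    unfolding pderiv_monom mult_1_right p0
    by (intro sum.cong) (auto simp: monom_eq_1)
  finally have dvG: "pderiv G = 1" by simp
  then show "\<exists>G. (\<forall>x :: 'a. poly G x = rel_trace p e l x) \<and> lead_coeff G = 1 \<and>
      Polynomial.degree G = (p ^ l) ^ (e div l - 1) \<and> pderiv G = 1"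
  proof (intro exI[of _ G] conjI allI)
    show "lead_coeff G = 1" using lc by (simp only: dG)
    show "Polynomial.degree G = (p ^ l) ^ (e div l - 1)" by (simp only: dG e_div Q_def diff_Suc_1)
  qed (use pG in simp_all)
  have qpow: "x ^ (Q ^ Suc d) = x" for x :: 'a
  proof (cases "x = 0")
    case False
    have "x ^ CARD('a) = x ^ (CARD('a) - 1) * x"
      by (rule power_minus_mult[symmetric]) simp
    then show ?thesis using power_CARD_minus_1[OF False] by (simp only: q mult_1_left)
  qed (use Q in \<open>simp add: power_0_left\<close>)
  have in_K: "poly G x \<in> K" for x
  proof -
    have "poly G x = (\<Sum>i<Suc d. x ^ (Q ^ i))" by (simp add: G_def poly_sum poly_monom)
    \<comment> \<open>Frobenius moves each summand to the next one, and the last wraps around to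
      \<open>x\<close>.\<close>
    moreover have "(\<Sum>i<Suc d. x ^ (Q ^ i)) ^ Q = (\<Sum>i<Suc d. x ^ (Q ^ Suc i))"
      unfolding Q_def sum_power_p_power by (simp add: ac_simps flip: power_mult)
    moreover have "(\<Sum>i<Suc d. x ^ (Q ^ Suc i)) = (\<Sum>i<d. x ^ (Q ^ Suc i)) + x"
      unfolding sum.lessThan_Suc qpow ..
    moreover have "(\<Sum>i<Suc d. x ^ (Q ^ i)) = x + (\<Sum>i<d. x ^ (Q ^ Suc i))"
      unfolding sum.lessThan_Suc_shift by simp
    ultimately show ?thesis by (simp add: fixed_field_def Q_def[symmetric] add.commute)
  qed
  have bound: "card {x. poly G x = c} \<le> Q ^ d" for c
  proof -
    have dF: "Polynomial.degree (G - [:c:]) = Q ^ d"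
      using dG Q unfolding diff_conv_add_uminus by (subst degree_add_eq_left) auto
    then have "G - [:c:] \<noteq> 0" using Q by auto
    then show ?thesis using card_poly_roots_bound[of "G - [:c:]"] dF by simp
  qed
  have "card {x. poly G x = b} = Q ^ d"
  proof (rule ccontr)
    assume "card {x. poly G x = b} \<noteq> Q ^ d"
    then have "card {x. poly G x = b} < Q ^ d" using bound[of b] by simp
    then have "(\<Sum>c\<in>K. card {x. poly G x = c}) < (\<Sum>c\<in>K. Q ^ d)"
      using bound assms(2) by (intro sum_strict_mono_ex1) auto
    moreover have "(\<Sum>c\<in>K. card {x. poly G x = c}) = CARD('a)"
      using in_K by (subst card_UN_disjoint[symmetric]) (auto intro!: arg_cong[of _ _ card])
    ultimately show False using card_K q by (simp add: Q_def)
  qed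
  then show "card {x. rel_trace p e l x = b} = (p ^ l) ^ (e div l - 1)"
    by (simp add: pG e_div Q_def)
qed

lemma evalset7_node_prod:
  assumes "e > 0" "evalset7 p e l S" "s \<in> S"
  shows "1 / node_prod S s \<in> K"
proof -
  obtain T where T: "T \<subseteq> K" and S: "S = {x. rel_trace p e l x \<in> T}"
    using assms(2) unfolding evalset7_def subfield_of_card_eq by blast
  obtain G where G: "\<And>x :: 'a. poly G x = rel_trace p e l x" "lead_coeff G = 1"
      "Polynomial.degree G = (p ^ l) ^ (e div l - 1)" "pderiv G = 1"
    using rel_trace_monic_poly[OF assms(1) zero_in_K] by blast
  have "node_prod S s = (\<Prod>b\<in>T - {rel_trace p e l s}. rel_trace p e l s - b)"
    using node_prod_preimage[of G T s] G(2-4) card_rel_trace_fibre[OF assms(1)] T assms(3) p_gt_1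
    by (auto simp: S G(1) subset_iff)
  also have "\<dots> \<in> K"
    using assms(3) T by (intro prod_in_K diff_in_K) (auto simp: S)
  finally show ?thesis by (simp add: divide_in_K one_in_K)
qed

end

section \<open>Dimension and minimum distance of linear codes\<close>

lemma finite_carrier_vec: "finite (carrier_vec N :: 'a :: finite vec set)"
proof -
  have "carrier_vec N \<subseteq> vec_of_list ` {xs :: 'a list. set xs \<subseteq> UNIV \<and> length xs = N}"
  proof
    fix x :: "'a vec" assume "x \<in> carrier_vec N"
    then have "x = vec_of_list (list_of_vec x)" "length (list_of_vec x) = N"
      by (auto simp: vec_list)
    then show "x \<in> vec_of_list ` {xs. set xs \<subseteq> UNIV \<and> length xs = N}" by blast
  qed
  then show ?thesis
    by (rule finite_subset) (intro finite_imageI finite_lists_length_eq, simp)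
qed

lemma inj_on_vec_index:
  assumes "x \<in> carrier_vec N" "distinct (list_of_vec x)"
  shows "inj_on (($) x) {..<N}"
  using assms by (force simp: inj_on_def distinct_conv_nth list_of_vec_index)

lemma subspace_vecI:
  fixes C :: "'a :: field vec set"
  assumes "C \<subseteq> carrier_vec N" "0\<^sub>v N \<in> C" "\<And>x y. x \<in> C \<Longrightarrow> y \<in> C \<Longrightarrow> x + y \<in> C"
    and "\<And>c x. x \<in> C \<Longrightarrow> c \<cdot>\<^sub>v x \<in> C"
  shows "VectorSpace.subspace class_ring C (module_vec TYPE('a) N)"
  unfolding VectorSpace.subspace_def submodule_def
  using assms vec_vs[where ?'a = 'a, of N] vec_module[where ?'a = 'a, of N]
  by (auto simp: module_vec_simps)

lemma card_subspace:
  fixes C :: "'a :: {field, finite} vec set"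
  assumes "VectorSpace.subspace class_ring C (module_vec TYPE('a) N)"
  shows "card C = CARD('a) ^ code_dim N C"
proof -
  interpret V: vectorspace "class_ring :: 'a ring" "module_vec TYPE('a) N" by (rule vec_vs)
  let ?W = "(module_vec TYPE('a) N)\<lparr>carrier := C\<rparr>"
  interpret W: vectorspace "class_ring :: 'a ring" ?W
    by (rule V.subspace_is_vs[OF assms])
  have "C \<subseteq> carrier_vec N"
    using assms unfolding VectorSpace.subspace_def submodule_def by (simp add: module_vec_simps)
  then have fin: "finite C" using finite_carrier_vec finite_subset by blast
  have "W.gen_set C"
    using W.in_own_span[of C] W.span_is_subset2[of C] by auto
  then have "W.fin_dim" unfolding W.fin_dim_def using fin by auto
  then obtain B where B: "finite B" "W.basis B" using W.finite_basis_exists by blast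
  then have BC: "B \<subseteq> C" by (simp add: W.basis_def)
  then have uniq: "\<exists>!a. a \<in> B \<rightarrow>\<^sub>E UNIV \<and> W.lincomb a B = v" if "v \<in> C" for v
    using W.basis_criterion[of B] B that by simp
  have "bij_betw (\<lambda>a. W.lincomb a B) (B \<rightarrow>\<^sub>E UNIV) C"
  proof (rule bij_betwI')
    have closed: "W.lincomb a B \<in> C" for a
      using W.lincomb_closed[of B a] BC by simp
    then show "W.lincomb a B \<in> C" for a .
    show "W.lincomb a B = W.lincomb b B \<longleftrightarrow> a = b"
      if "a \<in> B \<rightarrow>\<^sub>E UNIV" "b \<in> B \<rightarrow>\<^sub>E UNIV" for a b
      using uniq[OF closed[of a]] that by metis
    show "\<exists>a\<in>B \<rightarrow>\<^sub>E UNIV. v = W.lincomb a B" if "v \<in> C" for v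
      using uniq[OF that] by metis
  qed
  then have "card C = CARD('a) ^ card B"
    using B(1) by (metis bij_betw_same_card card_funcsetE)
  then show ?thesis using W.dim_basis[OF B] by (simp add: code_dim_def)
qed

text \<open>Over a finite field dimensions can be read off cardinalities, so no basis has to be
  exhibited for the code, its dual or its hull.\<close>

lemma code_dim_eqI:
  fixes C :: "'a :: {field, finite} vec set"
  assumes "VectorSpace.subspace class_ring C (module_vec TYPE('a) N)" "card C = CARD('a) ^ m"
  shows "code_dim N C = m"
proof -
  have "card {0, 1 :: 'a} \<le> CARD('a)" by (intro card_mono) auto
  then have "CARD('a) > 1" by simp
  then show ?thesis
    using card_subspace[OF assms(1)] assms(2) by (simp add: power_inject_exp)
qed

definition weight :: "'a :: zero vec \<Rightarrow> nat" where
  "weight x = card {i. i < dim_vec x \<and> x $ i \<noteq> 0}"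

lemma has_min_distI:
  fixes C :: "'a :: field vec set"
  assumes "VectorSpace.subspace class_ring C (module_vec TYPE('a) N)"
    and "x \<in> C" "x \<noteq> 0\<^sub>v N" "weight x = d"
    and "\<And>y. y \<in> C \<Longrightarrow> y \<noteq> 0\<^sub>v N \<Longrightarrow> d \<le> weight y"
  shows "has_min_dist C d"
proof -
  have C: "C \<subseteq> carrier_vec N" "0\<^sub>v N \<in> C" "\<And>x y. x \<in> C \<Longrightarrow> y \<in> C \<Longrightarrow> x + y \<in> C"
    "\<And>c x. x \<in> C \<Longrightarrow> c \<cdot>\<^sub>v x \<in> C"
    using assms(1) unfolding VectorSpace.subspace_def submodule_def by (auto simp: module_vec_simps)
  have dist: "hamming_dist u w = weight (u + (-1) \<cdot>\<^sub>v w)" if "u \<in> C" "w \<in> C" for u w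
  proof -
    have "dim_vec u = N" "dim_vec w = N" using that C(1) by auto
    then show ?thesis unfolding hamming_dist_def weight_def
      by (intro arg_cong[of _ _ card]) auto
  qed
  have ne: "u + (-1) \<cdot>\<^sub>v w \<noteq> 0\<^sub>v N" if uw: "u \<in> C" "w \<in> C" "u \<noteq> w" for u w
  proof
    assume eq: "u + (-1) \<cdot>\<^sub>v w = 0\<^sub>v N"
    have dims: "dim_vec u = N" "dim_vec w = N" using uw C(1) by auto
    have "u $ i = w $ i" if "i < N" for i
    proof -
      have "(u + (-1) \<cdot>\<^sub>v w) $ i = 0" using eq that by simp
      then show ?thesis using that dims by simp
    qed
    then show False using uw(3) dims by (metis eq_vecI)
  qed
  show ?thesis
    unfolding has_min_dist_def
  proof (intro conjI ballI impI)
    have "hamming_dist x (0\<^sub>v N) = weight x"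
      unfolding hamming_dist_def weight_def using assms(2) C(1)
      by (intro arg_cong[of _ _ card]) auto
    then show "\<exists>x\<in>C. \<exists>y\<in>C. x \<noteq> y \<and> hamming_dist x y = d"
      using assms C(2) by blast
    show "d \<le> hamming_dist u w" if "u \<in> C" "w \<in> C" "u \<noteq> w" for u w
      using that C ne[OF that] assms(5) by (simp add: dist)
  qed
qed

text \<open>Phrased with coefficients because \<open>degree 0 = 0\<close>: at \<open>k = 0\<close>
  this is the zero space, as a hull of dimension \<open>0\<close> requires, while a strict degree
  bound would give the empty set.\<close>

definition polys_below :: "nat \<Rightarrow> 'a :: zero poly set" where
  "polys_below k = {f. \<forall>i\<ge>k. Polynomial.coeff f i = 0}"

lemma polys_below_iff: "k > 0 \<Longrightarrow> f \<in> polys_below k \<longleftrightarrow> Polynomial.degree f < k"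
  unfolding polys_below_def
  by (auto intro: coeff_eq_0)
     (metis degree_0 leading_coeff_0_iff linorder_not_less)

lemma card_polys_below: "card (polys_below k :: 'a :: {field, finite} poly set) = CARD('a) ^ k"
proof -
  have "bij_betw (\<lambda>f. restrict (Polynomial.coeff f) {..<k}) (polys_below k)
    ({..<k} \<rightarrow>\<^sub>E (UNIV :: 'a set))"
  proof (rule bij_betwI')
    fix f g :: "'a poly" assume fg: "f \<in> polys_below k" "g \<in> polys_below k"
    show "restrict (Polynomial.coeff f) {..<k} = restrict (Polynomial.coeff g) {..<k} \<longleftrightarrow> f = g"
    proof
      assume eq: "restrict (Polynomial.coeff f) {..<k} = restrict (Polynomial.coeff g) {..<k}"
      show "f = g"
      proof (rule poly_eqI)
        fix i
        show "Polynomial.coeff f i = Polynomial.coeff g i"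
          using fun_cong[OF eq, of i] fg
          by (cases "i < k") (auto simp: polys_below_def)
      qed
    qed simp
  next
    fix c assume c: "c \<in> {..<k} \<rightarrow>\<^sub>E (UNIV :: 'a set)"
    define f where "f = (\<Sum>i<k. Polynomial.monom (c i) i)"
    have cf: "Polynomial.coeff f i = (if i < k then c i else 0)" for i
      by (simp add: f_def coeff_sum)
    then have "f \<in> polys_below k" by (simp add: polys_below_def)
    moreover have "c = restrict (Polynomial.coeff f) {..<k}"
      using c by (auto simp: cf PiE_def extensional_def restrict_def fun_eq_iff)
    ultimately show "\<exists>f\<in>polys_below k. c = restrict (Polynomial.coeff f) {..<k}" by blast
  qed auto
  then show ?thesis by (metis bij_betw_same_card card_funcsetE finite_lessThan card_lessThan)
qed

section \<open>Roth-Lempel codes with two extra coordinates\<close>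

locale roth_lempel =
  fixes n k :: nat and a v :: "'a :: {field, finite} vec" and \<zeta> :: 'a
  assumes k_ge: "3 \<le> k" and k_le: "k \<le> n"
    and a_carrier: "a \<in> carrier_vec n" and a_distinct: "distinct (list_of_vec a)"
    and v_carrier: "v \<in> carrier_vec n" and v_nonzero: "\<And>i. i < n \<Longrightarrow> v $ i \<noteq> 0"
begin

text \<open>The last two branches are the row vector of the top two coefficients multiplied by
  \<open>A_mat \<zeta>\<close>.\<close>

definition coord :: "'a poly \<Rightarrow> nat \<Rightarrow> 'a" where
  "coord f i = (if i < n then v $ i * poly f (a $ i)
     else if i = n then Polynomial.coeff f (k - 1)
     else Polynomial.coeff f (k - 2) + \<zeta> * Polynomial.coeff f (k - 1))"

definition enc :: "'a poly \<Rightarrow> 'a vec" where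
  "enc f = vec (n + 2) (coord f)"

abbreviation "C \<equiv> GRL k a v (A_mat \<zeta>)"

lemma inj_a: "inj_on (($) a) {..<n}"
  using a_carrier a_distinct by (rule inj_on_vec_index)

lemma GRL_params: "GRL_params n 2 k a v (A_mat \<zeta>)"
proof -
  \<comment> \<open>The explicit inverse; the determinant is \<open>-1\<close> for every
    \<open>\<zeta>\<close>.\<close>
  define B where "B = mat_of_rows_list 2 [[-\<zeta>, 1], [1, 0]]"
  have A: "A_mat \<zeta> \<in> carrier_mat 2 2" and B: "B \<in> carrier_mat 2 2"
    by (rule carrier_matI; simp add: A_mat_def B_def mat_of_rows_list_def)+
  have entries: "A_mat \<zeta> $$ (0, 0) = 0" "A_mat \<zeta> $$ (0, Suc 0) = 1" "A_mat \<zeta> $$ (Suc 0, 0) = 1"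
    "A_mat \<zeta> $$ (Suc 0, Suc 0) = \<zeta>" "B $$ (0, 0) = -\<zeta>" "B $$ (0, Suc 0) = 1"
    "B $$ (Suc 0, 0) = 1" "B $$ (Suc 0, Suc 0) = 0"
    by (simp_all add: A_mat_def B_def mat_of_rows_list_def)
  have "A_mat \<zeta> * B = 1\<^sub>m 2" "B * A_mat \<zeta> = 1\<^sub>m 2"
    by (rule eq_matI; use A B entries in \<open>auto simp: scalar_prod_def less_Suc_eq numeral_2_eq_2\<close>)+
  then have "invertible_mat (A_mat \<zeta>)"
    using A B unfolding invertible_mat_def inverts_mat_def by auto
  then show ?thesis
    using A k_ge k_le a_carrier a_distinct v_carrier v_nonzero by (simp add: GRL_params_def)
qed

lemma GRL_eq: "C = enc ` polys_below k"
proof -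
  have dims: "dim_vec a = n" "dim_row (A_mat \<zeta>) = 2"
    using a_carrier by (auto simp: A_mat_def mat_of_rows_list_def)
  have "vec n (\<lambda>i. v $ i * poly f (a $ i)) @\<^sub>v
    (transpose_mat (A_mat \<zeta>) *\<^sub>v vec 2 (\<lambda>j. Polynomial.coeff f (k - 2 + j))) = enc f" for f
  proof (rule eq_vecI)
    fix i assume "i < dim_vec (enc f)"
    then have "i < n \<or> i = n \<or> i = n + 1" by (auto simp: enc_def)
    moreover have "Suc (k - 2) = k - 1" using k_ge by simp
    ultimately show "(vec n (\<lambda>i. v $ i * poly f (a $ i)) @\<^sub>v
      (transpose_mat (A_mat \<zeta>) *\<^sub>v vec 2 (\<lambda>j. Polynomial.coeff f (k - 2 + j)))) $ i = enc f $ i"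
      by (auto simp: enc_def coord_def A_mat_def mat_of_rows_list_def scalar_prod_def
          numeral_2_eq_2)
  qed (simp add: enc_def A_mat_def mat_of_rows_list_def)
  then show ?thesis
    using k_ge unfolding GRL_def dims by (auto simp: polys_below_iff)
qed

lemma enc_carrier: "enc f \<in> carrier_vec (n + 2)"
  by (simp add: enc_def)

lemma coord_add: "coord (f + g) i = coord f i + coord g i"
  and coord_smult: "coord (Polynomial.smult c f) i = c * coord f i"
  by (simp_all add: coord_def algebra_simps)

lemma coord_0: "coord 0 i = 0" by (simp add: coord_def)

lemma coord_sum: "coord (\<Sum>s\<in>A. f s) i = (\<Sum>s\<in>A. coord (f s) i)"
  by (induction A rule: infinite_finite_induct) (auto simp: coord_0 coord_add)

lemma enc_add: "enc (f + g) = enc f + enc g"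
  and enc_smult: "enc (Polynomial.smult c f) = c \<cdot>\<^sub>v enc f"
  and enc_0: "enc 0 = 0\<^sub>v (n + 2)"
  by (rule eq_vecI; simp add: enc_def coord_add coord_smult coord_0)+

section \<open>Weights of codewords and the minimum distance\<close>

lemma weight_split:
  assumes "x \<in> carrier_vec (n + 2)"
  shows "weight x = card {i. i < n \<and> x $ i \<noteq> 0} + (if x $ n = 0 then 0 else 1) +
    (if x $ (n + 1) = 0 then 0 else 1)"
proof -
  define A where "A = {i. i < n \<and> x $ i \<noteq> 0}"
  define B where "B = (if x $ n = 0 then {} else {n})"
  define D where "D = (if x $ (n + 1) = 0 then {} else {n + 1})"
  have "{i. i < dim_vec x \<and> x $ i \<noteq> 0} = A \<union> (B \<union> D)"
    using assms by (auto simp: less_Suc_eq A_def B_def D_def)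
  moreover have "card (A \<union> (B \<union> D)) = card A + card (B \<union> D)" "card (B \<union> D) = card B + card D"
    by (rule card_Un_disjoint; force simp: A_def B_def D_def split: if_splits)+
  ultimately show ?thesis
    by (simp add: weight_def A_def B_def D_def)
qed

lemma weight_enc:
  "weight (enc f) = n - card {i. i < n \<and> poly f (a $ i) = 0} +
    (if Polynomial.coeff f (k - 1) = 0 then 0 else 1) +
    (if Polynomial.coeff f (k - 2) + \<zeta> * Polynomial.coeff f (k - 1) = 0 then 0 else 1)"
proof -
  have "{i. i < n \<and> enc f $ i \<noteq> 0} = {..<n} - {i. i < n \<and> poly f (a $ i) = 0}"
    using v_nonzero by (auto simp: enc_def coord_def)
  moreover have "card ({..<n} - {i. i < n \<and> poly f (a $ i) = 0}) =
      card {..<n} - card {i. i < n \<and> poly f (a $ i) = 0}"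
    by (rule card_Diff_subset) auto
  ultimately have "card {i. i < n \<and> enc f $ i \<noteq> 0} = n - card {i. i < n \<and> poly f (a $ i) = 0}"
    by simp
  then show ?thesis
    unfolding weight_split[OF enc_carrier] by (simp add: enc_def coord_def)
qed

lemma card_zero_positions:
  assumes "f \<noteq> 0"
  shows "card {i. i < n \<and> poly f (a $ i) = 0} \<le> Polynomial.degree f"
proof -
  have "card {i. i < n \<and> poly f (a $ i) = 0} = card (($) a ` {i. i < n \<and> poly f (a $ i) = 0})"
    by (rule card_image[symmetric]) (auto intro: inj_on_subset[OF inj_a])
  also have "\<dots> \<le> card {x. poly f x = 0}"
    by (intro card_mono) auto
  also have "\<dots> \<le> Polynomial.degree f" by (rule card_poly_roots_bound[OF assms])
  finally show ?thesis .
qed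

lemma Delta_I: "I \<subseteq> {..<n} \<Longrightarrow> card I = t \<Longrightarrow> (\<Sum>i\<in>I. a $ i) \<in> Delta t a"
  using a_carrier by (auto simp: Delta_def)

text \<open>The \<open>k - 1\<close> prescribed zeros exhaust the degree, so \<open>f\<close> is a
  multiple of their root polynomial and Vieta applies.\<close>

lemma coeffs_full_zeros:
  assumes "Polynomial.degree f = k - 1" "I \<subseteq> {..<n}" "card I = k - 1"
    and "\<And>i. i \<in> I \<Longrightarrow> poly f (a $ i) = 0"
  shows "Polynomial.coeff f (k - 2) = - lead_coeff f * (\<Sum>i\<in>I. a $ i)"
proof -
  define A where "A = ($) a ` I"
  have inj: "inj_on (($) a) I" using assms(2) by (rule inj_on_subset[OF inj_a])
  have fin: "finite I" using assms(2) finite_subset by blast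
  have card: "card A = k - 1" "finite A" using inj assms fin by (auto simp: A_def card_image)
  define c where "c = lead_coeff f"
  have "f \<noteq> 0" using assms(1) k_ge by auto
  then have "c \<noteq> 0" by (simp add: c_def)
  have "Polynomial.smult (1 / c) f = root_poly A"
    using assms \<open>c \<noteq> 0\<close> card by (intro monic_eq_root_poly) (auto simp: A_def c_def)
  then have "Polynomial.smult c (Polynomial.smult (1 / c) f) = Polynomial.smult c (root_poly A)"
    by (rule arg_cong)
  then have "f = Polynomial.smult c (root_poly A)" using \<open>c \<noteq> 0\<close> by simp
  moreover have "Polynomial.coeff (root_poly A) (card A - 1) = - \<Sum>A"
    using card k_ge by (intro second_coeff_root_poly) auto
  moreover have "card A - 1 = k - 2" using card by simp
  moreover have "\<Sum>A = (\<Sum>i\<in>I. a $ i)" unfolding A_def using inj by (simp add: sum.reindex)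
  ultimately show ?thesis unfolding c_def[symmetric] by simp
qed

text \<open>Degree at most \<open>k - 3\<close> leaves few enough zeros. Degree \<open>k - 2\<close>
  makes the last coordinate nonzero, degree \<open>k - 1\<close> the one before it, and each
  compensates one extra zero. Only with \<open>k - 1\<close> zeros does the last coordinate matter
  as well: it is the leading coefficient times \<open>\<zeta>\<close> minus a subset sum.\<close>

lemma weight_enc_ge:
  assumes "f \<in> polys_below k" "f \<noteq> 0"
  shows "weight (enc f) \<ge> n - k + (if \<zeta> \<in> Delta (k - 1) a then 2 else 3)"
proof -
  define Z where "Z = {i. i < n \<and> poly f (a $ i) = 0}"
  have deg: "Polynomial.degree f < k" using assms(1) k_ge by (simp add: polys_below_iff)
  have Z: "card Z \<le> Polynomial.degree f" "finite Z" "Z \<subseteq> {..<n}"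
    using card_zero_positions[OF assms(2)] by (auto simp: Z_def)
  note w = weight_enc[of f, folded Z_def]
  consider "Polynomial.degree f \<le> k - 3" | "Polynomial.degree f = k - 2"
    | "Polynomial.degree f = k - 1" "card Z \<le> k - 2" | "Polynomial.degree f = k - 1" "card Z = k - 1"
    using deg Z(1) by linarith
  then show ?thesis
  proof cases
    case 1
    then show ?thesis unfolding w using Z(1) k_ge k_le by auto
  next
    case 2
    have "Polynomial.coeff f (k - 1) = 0" by (rule coeff_eq_0) (use 2 k_ge in simp)
    moreover have "Polynomial.coeff f (k - 2) \<noteq> 0" using 2 assms(2) by (metis leading_coeff_0_iff)
    ultimately show ?thesis unfolding w using Z(1) 2 k_ge k_le by auto
  next
    case 3
    then have "Polynomial.coeff f (k - 1) \<noteq> 0" using assms(2) by (metis leading_coeff_0_iff)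
    then show ?thesis unfolding w using 3 k_ge k_le by auto
  next
    case 4
    have lc: "Polynomial.coeff f (k - 1) \<noteq> 0" using 4 assms(2) by (metis leading_coeff_0_iff)
    have "Polynomial.coeff f (k - 2) = - lead_coeff f * (\<Sum>i\<in>Z. a $ i)"
      by (rule coeffs_full_zeros) (use 4 Z in \<open>auto simp: Z_def\<close>)
    then have "Polynomial.coeff f (k - 2) + \<zeta> * Polynomial.coeff f (k - 1) =
      Polynomial.coeff f (k - 1) * (\<zeta> - (\<Sum>i\<in>Z. a $ i))"
      using 4 by (simp add: algebra_simps)
    moreover have "(\<Sum>i\<in>Z. a $ i) \<in> Delta (k - 1) a" using Delta_I Z 4 by blast
    ultimately show ?thesis unfolding w using lc 4 k_ge k_le by auto
  qed
qed

lemma inj_enc: "inj_on enc (polys_below k)"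
proof (rule inj_onI)
  fix f g assume fg: "f \<in> polys_below k" "g \<in> polys_below k" "enc f = enc g"
  have diff: "f - g \<in> polys_below k" using fg by (simp add: polys_below_def)
  have "enc (f - g) = 0\<^sub>v (n + 2)"
  proof -
    have "enc (f - g) = enc f + (-1) \<cdot>\<^sub>v enc g"
      using enc_add[of f "Polynomial.smult (-1) g"] enc_smult[of "-1" g] by simp
    also have "\<dots> = 0\<^sub>v (n + 2)"
      unfolding fg(3) by (rule eq_vecI) (simp_all add: enc_def)
    finally show ?thesis .
  qed
  then have w: "weight (enc (f - g)) = 0" by (auto simp: weight_def)
  show "f = g"
  proof (rule ccontr)
    assume "f \<noteq> g"
    then show False using weight_enc_ge[OF diff] w by (simp split: if_splits)
  qed
qed

text \<open>The factor \<open>R\<close> allows one treatment of the code itself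
  (\<open>R = 1\<close>, \<open>h = k\<close>) and of its hull, where \<open>R\<close> is a root
  polynomial.\<close>

lemma subspace_enc_image:
  "VectorSpace.subspace class_ring ((\<lambda>g. enc (R * g)) ` polys_below h) (module_vec TYPE('a) (n + 2))"
proof (rule subspace_vecI)
  have "0 \<in> polys_below h" by (simp add: polys_below_def)
  then show "0\<^sub>v (n + 2) \<in> (\<lambda>g. enc (R * g)) ` polys_below h"
    by (auto simp: enc_0 intro!: rev_image_eqI[of 0])
  show "x + y \<in> (\<lambda>g. enc (R * g)) ` polys_below h"
    if xy: "x \<in> (\<lambda>g. enc (R * g)) ` polys_below h" "y \<in> (\<lambda>g. enc (R * g)) ` polys_below h" for x y
  proof -
    obtain f g where fg: "f \<in> polys_below h" "g \<in> polys_below h" "x = enc (R * f)" "y = enc (R * g)"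
      using xy by blast
    have "f + g \<in> polys_below h" using fg by (simp add: polys_below_def)
    moreover have "x + y = enc (R * (f + g))" using fg by (simp add: enc_add ring_distribs)
    ultimately show ?thesis by blast
  qed
  show "c \<cdot>\<^sub>v x \<in> (\<lambda>g. enc (R * g)) ` polys_below h"
    if x: "x \<in> (\<lambda>g. enc (R * g)) ` polys_below h" for c x
  proof -
    obtain f where f: "f \<in> polys_below h" "x = enc (R * f)" using x by blast
    have "Polynomial.smult c f \<in> polys_below h" using f by (simp add: polys_below_def)
    moreover have "c \<cdot>\<^sub>v x = enc (R * Polynomial.smult c f)"
      using f by (simp add: enc_smult)
    ultimately show ?thesis by blast
  qed
qed (use enc_carrier in auto)

lemma code_dim_enc_image:
  assumes "R \<noteq> 0" "\<And>g. g \<in> polys_below h \<Longrightarrow> R * g \<in> polys_below k"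
  shows "code_dim (n + 2) ((\<lambda>g. enc (R * g)) ` polys_below h) = h"
proof (rule code_dim_eqI[OF subspace_enc_image])
  have "inj_on (\<lambda>g. enc (R * g)) (polys_below h)"
  proof (rule inj_onI)
    fix f g assume "f \<in> polys_below h" "g \<in> polys_below h" "enc (R * f) = enc (R * g)"
    then have "R * f = R * g" using inj_onD[OF inj_enc] assms(2) by blast
    then show "f = g" using assms(1) by simp
  qed
  then show "card ((\<lambda>g. enc (R * g)) ` polys_below h) = CARD('a) ^ h"
    by (simp add: card_image card_polys_below)
qed

lemma subspace_C: "VectorSpace.subspace class_ring C (module_vec TYPE('a) (n + 2))"
  using subspace_enc_image[of 1 k] by (simp add: GRL_eq)

lemma code_dim_C: "code_dim (n + 2) C = k"
  using code_dim_enc_image[of 1 k] by (simp add: GRL_eq)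

lemma linear_code_C:
  "linear_code (n + 2) k (n - k + (if \<zeta> \<in> Delta (k - 1) a then 2 else 3)) C"
proof -
  have "\<exists>f\<in>polys_below k. f \<noteq> 0 \<and>
    weight (enc f) = n - k + (if \<zeta> \<in> Delta (k - 1) a then 2 else 3)"
  proof (cases "\<zeta> \<in> Delta (k - 1) a")
    case True
    then obtain I where I: "I \<subseteq> {..<n}" "card I = k - 1" "\<zeta> = (\<Sum>i\<in>I. a $ i)"
      using a_carrier by (auto simp: Delta_def)
    have fin: "finite I" using I finite_subset by blast
    \<comment> \<open>The zeros are the subset summing to \<open>\<zeta>\<close>; this kills the
      last coordinate, and the leading coefficient alone survives in the tail.\<close>
    define f where "f = root_poly (($) a ` I)"
    have deg: "Polynomial.degree f = k - 1"
      using I inj_on_subset[OF inj_a I(1)] by (simp add: f_def degree_root_poly card_image)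
    have lc: "lead_coeff f = 1" unfolding f_def
      using lead_coeff_root_poly by (simp add: degree_root_poly)
    have "{i. i < n \<and> poly f (a $ i) = 0} = I"
      using I(1) fin inj_a by (auto simp: f_def poly_root_poly_eq_0_iff dest!: inj_onD)
    moreover have "Polynomial.coeff f (k - 2) = - lead_coeff f * \<zeta>"
      unfolding I(3) by (rule coeffs_full_zeros) (use deg I fin in \<open>auto simp: f_def poly_root_poly_eq_0_iff\<close>)
    ultimately have "weight (enc f) = n - k + 2"
      unfolding weight_enc using lc k_ge k_le I(2) by (simp add: deg)
    moreover have "f \<in> polys_below k" using k_ge deg by (simp add: polys_below_iff)
    ultimately show ?thesis using True root_poly_neq_0 by (auto simp: f_def)
  next
    case False
    \<comment> \<open>With degree \<open>k - 3\<close> both extra coordinates vanish, leaving weight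
      \<open>n - (k - 3)\<close>.\<close>
    define f where "f = root_poly (($) a ` {..<k - 3})"
    have sub: "{..<k - 3} \<subseteq> {..<n}" using k_le by auto
    have deg: "Polynomial.degree f = k - 3"
      using inj_on_subset[OF inj_a sub] by (simp add: f_def degree_root_poly card_image)
    have "{i. i < n \<and> poly f (a $ i) = 0} = {..<k - 3}"
      using sub inj_a by (auto simp: f_def poly_root_poly_eq_0_iff dest!: inj_onD)
    moreover have "Polynomial.coeff f (k - 2) = 0" "Polynomial.coeff f (k - 1) = 0"
      using k_ge by (auto simp: deg intro!: coeff_eq_0)
    ultimately have "weight (enc f) = n - k + 3"
      unfolding weight_enc using k_ge k_le by simp
    moreover have "f \<in> polys_below k" using k_ge deg by (simp add: polys_below_iff)
    ultimately show ?thesis using False root_poly_neq_0 by (auto simp: f_def)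
  qed
  then obtain f where f: "f \<in> polys_below k" "f \<noteq> 0"
    "weight (enc f) = n - k + (if \<zeta> \<in> Delta (k - 1) a then 2 else 3)" by blast
  have "has_min_dist C (n - k + (if \<zeta> \<in> Delta (k - 1) a then 2 else 3))"
  proof (rule has_min_distI[OF subspace_C _ _ f(3)])
    show "enc f \<in> C" using f by (simp add: GRL_eq)
    show "enc f \<noteq> 0\<^sub>v (n + 2)"
    proof
      assume "enc f = 0\<^sub>v (n + 2)"
      then have "weight (enc f) = 0" by (simp add: weight_def)
      then show False using f(3) by (simp split: if_splits)
    qed
    fix y assume y: "y \<in> C" "y \<noteq> 0\<^sub>v (n + 2)"
    then obtain g where g: "g \<in> polys_below k" "y = enc g" by (auto simp: GRL_eq)
    then have "g \<noteq> 0" using y enc_0 by auto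
    then show "n - k + (if \<zeta> \<in> Delta (k - 1) a then 2 else 3) \<le> weight y"
      using weight_enc_ge g by blast
  qed
  then show ?thesis using subspace_C code_dim_C by (simp add: linear_code_def)
qed

end

context roth_lempel
begin

lemma scalar_prod_split:
  assumes "x \<in> carrier_vec (n + 2)" "y \<in> carrier_vec (n + 2)"
  shows "x \<bullet> y = (\<Sum>i<n. x $ i * y $ i) + x $ n * y $ n + x $ (n + 1) * y $ (n + 1)"
proof -
  have "x \<bullet> y = (\<Sum>i<Suc (Suc n). x $ i * y $ i)"
    using assms by (simp add: scalar_prod_def atLeast0LessThan)
  then show ?thesis by simp
qed

subsection \<open>The Euclidean dual\<close>

lemma enc_scalar_prod:
  assumes "x \<in> carrier_vec (n + 2)"
  shows "enc f \<bullet> x = (\<Sum>i<n. v $ i * poly f (a $ i) * x $ i) + Polynomial.coeff f (k - 1) * x $ n +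
    (Polynomial.coeff f (k - 2) + \<zeta> * Polynomial.coeff f (k - 1)) * x $ (n + 1)"
  unfolding scalar_prod_split[OF enc_carrier assms] by (simp add: enc_def coord_def)

lemma euclidean_dual_iff:
  "x \<in> euclidean_dual (n + 2) C \<longleftrightarrow> x \<in> carrier_vec (n + 2) \<and>
    (\<forall>f\<in>polys_below k. (\<Sum>i<n. v $ i * poly f (a $ i) * x $ i) + Polynomial.coeff f (k - 1) * x $ n +
      (Polynomial.coeff f (k - 2) + \<zeta> * Polynomial.coeff f (k - 1)) * x $ (n + 1) = 0)"
  unfolding euclidean_dual_def GRL_eq using enc_scalar_prod by auto

lemma subspace_dual:
  "VectorSpace.subspace class_ring (euclidean_dual (n + 2) C) (module_vec TYPE('a) (n + 2))"
proof (rule subspace_vecI)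
  have c: "c \<in> carrier_vec (n + 2)" if "c \<in> C" for c using that enc_carrier by (auto simp: GRL_eq)
  show "0\<^sub>v (n + 2) \<in> euclidean_dual (n + 2) C" using c by (simp add: euclidean_dual_def)
  show "x + y \<in> euclidean_dual (n + 2) C"
    if "x \<in> euclidean_dual (n + 2) C" "y \<in> euclidean_dual (n + 2) C" for x y
    using that c by (simp add: euclidean_dual_def scalar_prod_add_distrib[of _ "n + 2"])
  show "b \<cdot>\<^sub>v x \<in> euclidean_dual (n + 2) C" if "x \<in> euclidean_dual (n + 2) C" for b x
    using that c by (auto simp: euclidean_dual_def scalar_prod_smult_distrib[of _ "n + 2"])
qed (simp add: euclidean_dual_def)

text \<open>Pair \<open>x\<close> with the root polynomial of all support points but one. Under the
  first alternative its degree is at most \<open>k - 3\<close>, so the extra coordinates do not see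
  it; under the second they are zero in \<open>x\<close>. The first alternative bounds the dual
  distance, the second also makes the dimension count injective.\<close>

lemma dual_eq_0I:
  assumes x: "x \<in> euclidean_dual (n + 2) C"
    and supp: "card {i. i < n \<and> x $ i \<noteq> 0} + 2 \<le> k \<or>
      (x $ n = 0 \<and> x $ (n + 1) = 0 \<and> card {i. i < n \<and> x $ i \<noteq> 0} \<le> k)"
  shows "x = 0\<^sub>v (n + 2)"
proof -
  define J where "J = {i. i < n \<and> x $ i \<noteq> 0}"
  have [simp]: "finite J" by (simp add: J_def)
  have car: "x \<in> carrier_vec (n + 2)"
    and pair: "(\<Sum>i<n. v $ i * poly f (a $ i) * x $ i) + Polynomial.coeff f (k - 1) * x $ n +
      (Polynomial.coeff f (k - 2) + \<zeta> * Polynomial.coeff f (k - 1)) * x $ (n + 1) = 0"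
    if "f \<in> polys_below k" for f
    using x that unfolding euclidean_dual_iff by blast+
  have inj: "inj_on (($) a) (J - {j})" for j
    by (rule inj_on_subset[OF inj_a]) (auto simp: J_def)
  have "x $ j = 0" if j: "j < n" for j
  proof (rule ccontr)
    assume nz: "x $ j \<noteq> 0"
    then have jJ: "j \<in> J" using j by (simp add: J_def)
    define f where "f = root_poly (($) a ` (J - {j}))"
    have deg: "Polynomial.degree f = card J - 1"
      using jJ inj by (simp add: f_def degree_root_poly card_image)
    have "card J > 0" using jJ by (auto simp: card_gt_0_iff)
    have "card J \<le> k" using supp by (auto simp: J_def)
    then have f: "f \<in> polys_below k" using deg k_ge \<open>card J > 0\<close> by (simp add: polys_below_iff)
    have tail: "Polynomial.coeff f (k - 1) * x $ n +
      (Polynomial.coeff f (k - 2) + \<zeta> * Polynomial.coeff f (k - 1)) * x $ (n + 1) = 0"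
    proof (cases "card J + 2 \<le> k")
      case True
      then have "Polynomial.coeff f (k - 1) = 0" "Polynomial.coeff f (k - 2) = 0"
        using deg \<open>card J > 0\<close> by (auto intro!: coeff_eq_0)
      then show ?thesis by simp
    next
      case False
      then show ?thesis using supp by (simp add: J_def)
    qed
    have "(\<Sum>i<n. v $ i * poly f (a $ i) * x $ i) =
        (\<Sum>i<n. if i = j then v $ j * poly f (a $ j) * x $ j else 0)"
      by (intro sum.cong) (auto simp: f_def poly_root_poly_eq_0_iff J_def)
    then have "v $ j * poly f (a $ j) * x $ j = 0"
      using pair[OF f] tail j by (simp add: add.assoc)
    moreover have "poly f (a $ j) \<noteq> 0"
      using j inj_a by (auto simp: f_def poly_root_poly_eq_0_iff J_def dest: inj_onD)
    ultimately show False using nz v_nonzero[OF j] by simp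
  qed
  then have head: "(\<Sum>i<n. v $ i * poly f (a $ i) * x $ i) = 0" for f by simp
  have mem: "Polynomial.monom 1 (k - 2) \<in> polys_below k" "Polynomial.monom 1 (k - 1) \<in> polys_below k"
    using k_ge by (auto simp: polys_below_def)
  have ne: "k - 1 \<noteq> k - 2" "k - 2 \<noteq> k - 1" using k_ge by auto
  have "x $ (n + 1) = 0" using pair[OF mem(1)] head ne by simp
  moreover from this have "x $ n = 0" using pair[OF mem(2)] head ne by simp
  ultimately have "x $ (n + 1) = 0" "x $ n = 0" by simp_all
  then show ?thesis using \<open>\<And>j. j < n \<Longrightarrow> x $ j = 0\<close> car[of 0]
    by (intro eq_vecI) (auto simp: less_Suc_eq polys_below_def)
qed

text \<open>By interpolation the first \<open>k\<close> positions form an information set of the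
  code, so the other \<open>n + 2 - k\<close> entries of a dual word are free and determine
  it.\<close>

lemma code_dim_dual: "code_dim (n + 2) (euclidean_dual (n + 2) C) = n + 2 - k"
proof (rule code_dim_eqI[OF subspace_dual])
  let ?D = "euclidean_dual (n + 2) C"
  define A where "A = ($) a ` {..<k}"
  have inj: "inj_on (($) a) {..<k}" by (rule inj_on_subset[OF inj_a]) (use k_le in auto)
  have A: "finite A" "card A = k" using inj by (auto simp: A_def card_image)
  define L where "L s = Polynomial.smult (1 / node_prod A s) (root_poly (A - {s}))" for s
  have interp: "f = (\<Sum>i<k. Polynomial.smult (poly f (a $ i)) (L (a $ i)))" if "f \<in> polys_below k" for f
  proof -
    have "f = (\<Sum>s\<in>A. Polynomial.smult (poly f s / node_prod A s) (root_poly (A - {s})))"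
      using that k_ge A by (intro lagrange_interpolation) (auto simp: polys_below_iff)
    also have "\<dots> = (\<Sum>i<k. Polynomial.smult (poly f (a $ i)) (L (a $ i)))"
      unfolding A_def by (subst sum.reindex[OF inj]) (simp add: L_def A_def)
    finally show ?thesis .
  qed
  have coordL: "coord f j = (\<Sum>i<k. poly f (a $ i) * coord (L (a $ i)) j)" if "f \<in> polys_below k" for f j
    by (subst interp[OF that]) (simp add: coord_sum coord_smult)
  have pair: "x \<in> ?D \<longleftrightarrow> x \<in> carrier_vec (n + 2) \<and> (\<forall>f\<in>polys_below k. (\<Sum>j<n + 2. coord f j * x $ j) = 0)" for x
    unfolding euclidean_dual_iff by (simp add: coord_def)
  have "bij_betw (\<lambda>x. restrict (($) x) {k..<n + 2}) ?D ({k..<n + 2} \<rightarrow>\<^sub>E (UNIV :: 'a set))"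
  proof (rule bij_betwI')
    fix x y assume xy: "x \<in> ?D" "y \<in> ?D"
    show "restrict (($) x) {k..<n + 2} = restrict (($) y) {k..<n + 2} \<longleftrightarrow> x = y"
    proof
      assume eq: "restrict (($) x) {k..<n + 2} = restrict (($) y) {k..<n + 2}"
      have car: "x \<in> carrier_vec (n + 2)" "y \<in> carrier_vec (n + 2)"
        using xy by (auto simp: euclidean_dual_def)
      have tail: "x $ i = y $ i" if "k \<le> i" "i < n + 2" for i
        using fun_cong[OF eq, of i] that by simp
      define z where "z = x + (-1) \<cdot>\<^sub>v y"
      have z: "z $ i = x $ i - y $ i" if "i < n + 2" for i
        using that car by (simp add: z_def)
      have "z \<in> ?D"
        unfolding pair
      proof (intro conjI ballI)
        show "z \<in> carrier_vec (n + 2)" using car by (simp add: z_def)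
        fix f :: "'a poly" assume f: "f \<in> polys_below k"
        have "(\<Sum>j<n + 2. coord f j * z $ j) = (\<Sum>j<n + 2. coord f j * x $ j) - (\<Sum>j<n + 2. coord f j * y $ j)"
          unfolding sum_subtractf[symmetric] by (intro sum.cong) (auto simp: z right_diff_distrib)
        moreover have "(\<Sum>j<n + 2. coord f j * x $ j) = 0" "(\<Sum>j<n + 2. coord f j * y $ j) = 0"
          using xy f unfolding pair by blast+
        ultimately show "(\<Sum>j<n + 2. coord f j * z $ j) = 0" by (simp only: diff_self)
      qed
      moreover have "i < k" if "i < n" "z $ i \<noteq> 0" for i
        using that z[of i] tail[of i] by (cases "i < k") auto
      then have "card {i. i < n \<and> z $ i \<noteq> 0} \<le> card {..<k}"
        by (intro card_mono) auto
      ultimately have "z = 0\<^sub>v (n + 2)"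
        using k_le tail by (intro dual_eq_0I) (auto simp: z)
      then have "x $ i = y $ i" if "i < n + 2" for i using z[OF that] that by simp
      then show "x = y" using car by (intro eq_vecI) auto
    qed simp
  next
    fix r assume r: "r \<in> {k..<n + 2} \<rightarrow>\<^sub>E (UNIV :: 'a set)"
    define S where "S j = (\<Sum>t\<in>{k..<n + 2}. coord (L (a $ j)) t * r t)" for j
    \<comment> \<open>Solves the pairing with the basis polynomial \<open>L (a $ j)\<close>, whose
      coordinates among the first \<open>k\<close> are zero except for \<open>v $ j\<close> at
      \<open>j\<close>.\<close>
    define x where "x = vec (n + 2) (\<lambda>j. if k \<le> j then r j else - S j / v $ j)"
    have "(\<Sum>j<n + 2. coord f j * x $ j) = 0" if f: "f \<in> polys_below k" for f
    proof -
      have split: "{..<n + 2} = {..<k} \<union> {k..<n + 2}" using k_le by auto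
      have "(\<Sum>j<n + 2. coord f j * x $ j) = (\<Sum>j<k. coord f j * x $ j) + (\<Sum>j\<in>{k..<n + 2}. coord f j * x $ j)"
        unfolding split by (rule sum.union_disjoint) auto
      also have "(\<Sum>j<k. coord f j * x $ j) = (\<Sum>j<k. - (poly f (a $ j) * S j))"
        using k_le v_nonzero by (intro sum.cong) (auto simp: x_def coord_def[of f])
      also have "\<dots> = (\<Sum>j<k. - (\<Sum>t\<in>{k..<n + 2}. poly f (a $ j) * coord (L (a $ j)) t * r t))"
        unfolding S_def sum_distrib_left by (simp only: mult.assoc)
      also have "\<dots> = - (\<Sum>t\<in>{k..<n + 2}. \<Sum>j<k. poly f (a $ j) * coord (L (a $ j)) t * r t)"
        unfolding sum_negf by (subst sum.swap) simp
      also have "(\<Sum>t\<in>{k..<n + 2}. \<Sum>j<k. poly f (a $ j) * coord (L (a $ j)) t * r t) =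
          (\<Sum>j\<in>{k..<n + 2}. coord f j * x $ j)"
        by (intro sum.cong) (auto simp: coordL[OF f] x_def sum_distrib_right)
      finally show ?thesis by simp
    qed
    then have "x \<in> ?D" unfolding pair by (simp add: x_def)
    moreover have "r = restrict (($) x) {k..<n + 2}"
      using r by (auto simp: x_def PiE_def extensional_def restrict_def fun_eq_iff)
    ultimately show "\<exists>x\<in>?D. r = restrict (($) x) {k..<n + 2}" by blast
  qed auto
  then show "card ?D = CARD('a) ^ (n + 2 - k)"
    by (metis bij_betw_same_card card_funcsetE finite_atLeastLessThan card_atLeastLessThan)
qed

lemma linear_code_dual:
  assumes "\<zeta> \<in> Delta (k - 1) a"
  shows "linear_code (n + 2) (n + 2 - k) k (euclidean_dual (n + 2) C)"
proof -
  let ?D = "euclidean_dual (n + 2) C"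
  obtain I where I: "I \<subseteq> {..<n}" "card I = k - 1" "\<zeta> = (\<Sum>i\<in>I. a $ i)"
    using assms a_carrier by (auto simp: Delta_def)
  have fin: "finite I" using I finite_subset by blast
  have inj: "inj_on (($) a) I" using inj_a I(1) by (rule inj_on_subset)
  define A where "A = ($) a ` I"
  have A: "finite A" "card A = k - 1" using fin inj I by (auto simp: A_def card_image)
  have "A \<noteq> {}" using A k_ge by auto
  \<comment> \<open>On \<open>I\<close> the interpolation sum reproduces \<open>Polynomial.coeff f
    (k - 2) + \<zeta> * Polynomial.coeff f (k - 1)\<close>, and the entry \<open>-1\<close> cancels
    the same expression in the last coordinate. The weight is \<open>(k - 1) + 1\<close>.\<close>
  define x where "x = vec (n + 2) (\<lambda>i. if i \<in> I then 1 / (v $ i * node_prod A (a $ i))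
    else if i = n + 1 then -1 else 0)"
  have nI: "n \<notin> I" "Suc n \<notin> I" using I(1) by auto
  have "(\<Sum>i<n. v $ i * poly f (a $ i) * x $ i) + Polynomial.coeff f (k - 1) * x $ n +
      (Polynomial.coeff f (k - 2) + \<zeta> * Polynomial.coeff f (k - 1)) * x $ (n + 1) = 0"
    if f: "f \<in> polys_below k" for f
  proof -
    have deg: "Polynomial.degree f < k" using f k_ge by (simp add: polys_below_iff)
    have "(\<Sum>i<n. v $ i * poly f (a $ i) * x $ i) = (\<Sum>i\<in>I. poly f (a $ i) / node_prod A (a $ i))"
      using I(1) v_nonzero by (intro sum.mono_neutral_cong_right) (auto simp: x_def)
    also have "\<dots> = (\<Sum>s\<in>A. poly f s / node_prod A s)"
      unfolding A_def by (simp add: sum.reindex[OF inj])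
    also have "\<dots> = Polynomial.coeff f (card A - 1) + Polynomial.coeff f (card A) * \<Sum>A"
      using deg A \<open>A \<noteq> {}\<close> by (intro sum_over_node_prod_degree_le_card) auto
    also have "\<Sum>A = \<zeta>" unfolding A_def I(3) by (simp add: sum.reindex[OF inj])
    also have "card A - 1 = k - 2" using A by simp
    finally show ?thesis using nI A by (simp add: x_def mult.commute)
  qed
  moreover have "x \<in> carrier_vec (n + 2)" by (simp add: x_def)
  ultimately have xD: "x \<in> ?D" unfolding euclidean_dual_iff by blast
  have "{i. i < n \<and> x $ i \<noteq> 0} = I"
    using I(1) v_nonzero node_prod_neq_0[OF A(1)] by (auto simp: x_def split: if_splits)
  then have wx: "weight x = k"
    using nI I k_ge by (subst weight_split) (auto simp: x_def)
  have "has_min_dist ?D k"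
  proof (rule has_min_distI[OF subspace_dual xD _ wx])
    show "x \<noteq> 0\<^sub>v (n + 2)"
    proof
      assume "x = 0\<^sub>v (n + 2)"
      then have "weight x = 0" by (auto simp: weight_def)
      then show False using wx k_ge by simp
    qed
    fix y assume y: "y \<in> ?D" "y \<noteq> 0\<^sub>v (n + 2)"
    then have "y \<in> carrier_vec (n + 2)" by (simp add: euclidean_dual_def)
    from weight_split[OF this] show "k \<le> weight y"
      using dual_eq_0I[OF y(1)] y(2) by (auto split: if_splits)
  qed
  then show ?thesis using subspace_dual code_dim_dual by (simp add: linear_code_def)
qed

lemma NMDS_C:
  assumes "\<zeta> \<in> Delta (k - 1) a"
  shows "NMDS (n + 2) C"
  unfolding NMDS_def AMDS_def
proof (intro conjI exI)
  show "linear_code (n + 2) k (n - k + 2) C" using linear_code_C assms by simp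
  show "linear_code (n + 2) (n + 2 - k) k (euclidean_dual (n + 2) C)"
    using assms by (rule linear_code_dual)
qed (use k_le in auto)

lemma MDS_C:
  assumes "\<zeta> \<notin> Delta (k - 1) a"
  shows "MDS (n + 2) C"
  unfolding MDS_def
proof (intro exI conjI)
  show "linear_code (n + 2) k (n - k + 3) C" using linear_code_C assms by simp
qed (use k_le in auto)

subsection \<open>The Galois hull\<close>

lemma galois_inner_enc:
  "galois_inner p l (enc f) (enc g) =
    (\<Sum>i<n. (v $ i) ^ (p ^ l + 1) * (poly f (a $ i) * poly g (a $ i) ^ (p ^ l))) +
    Polynomial.coeff f (k - 1) * Polynomial.coeff g (k - 1) ^ (p ^ l) +
    (Polynomial.coeff f (k - 2) + \<zeta> * Polynomial.coeff f (k - 1)) *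
    (Polynomial.coeff g (k - 2) + \<zeta> * Polynomial.coeff g (k - 1)) ^ (p ^ l)"
  unfolding galois_inner_def
  by (subst scalar_prod_split)
    (auto simp: enc_carrier enc_def coord_def power_mult_distrib ac_simps intro!: sum.cong)

text \<open>The Galois form on the message polynomials is a nondegenerate diagonal form in the evaluations
  at \<open>Z\<close> and the two extra coordinates, so its radical consists of the multiples of
  \<open>root_poly Z\<close> of degree below \<open>k - 2\<close>.\<close>

lemma code_dim_galois_hull:
  assumes "p ^ l > 0" "finite Z" "card Z + 2 + h = k" "\<And>z. z \<in> Z \<Longrightarrow> c z \<noteq> 0"
    and form: "\<And>f g. f \<in> polys_below k \<Longrightarrow> g \<in> polys_below k \<Longrightarrow>
      (\<Sum>i<n. (v $ i) ^ (p ^ l + 1) * (poly f (a $ i) * poly g (a $ i) ^ (p ^ l))) =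
      (\<Sum>z\<in>Z. c z * (poly f z * poly g z ^ (p ^ l)))"
  shows "code_dim (n + 2) (galois_hull p l (n + 2) C) = h"
proof -
  let ?Q = "p ^ l"
  have zero_Q: "(0 :: 'a) ^ ?Q = 0" using assms(1) by (rule zero_power)
  have below: "root_poly Z * g \<in> polys_below (k - 2)" if g: "g \<in> polys_below h" for g
  proof (cases "g = 0")
    case True
    then show ?thesis by (simp add: polys_below_def)
  next
    case False
    then have "h \<noteq> 0" using g by (cases h) (auto simp: polys_below_def poly_eq_iff)
    then have "Polynomial.degree g < h" using g by (simp add: polys_below_iff)
    moreover have "Polynomial.degree (root_poly Z * g) = card Z + Polynomial.degree g"
      using False by (subst degree_mult_eq) (auto simp: root_poly_neq_0 degree_root_poly)
    ultimately show ?thesis using assms(3) by (simp add: polys_below_iff)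
  qed
  have below_k: "f \<in> polys_below k" if "f \<in> polys_below (k - 2)" for f :: "'a poly"
    using that by (simp add: polys_below_def)
  have radical: "(\<forall>f\<in>polys_below k. galois_inner p l (enc f) (enc g) = 0) \<longleftrightarrow>
    g \<in> (*) (root_poly Z) ` polys_below h" if g: "g \<in> polys_below k" for g
  proof
    assume "g \<in> (*) (root_poly Z) ` polys_below h"
    then obtain g' where g': "g' \<in> polys_below h" "g = root_poly Z * g'" by blast
    have "Polynomial.coeff g (k - 1) = 0" "Polynomial.coeff g (k - 2) = 0"
      using below[OF g'(1)] by (auto simp: g'(2) polys_below_def)
    moreover have "poly g z = 0" if "z \<in> Z" for z
      using that poly_root_poly_eq_0_iff[OF assms(2)] by (simp add: g'(2))
    ultimately have "galois_inner p l (enc f) (enc g) = 0" if "f \<in> polys_below k" for f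
      unfolding galois_inner_enc form[OF that g] by (simp add: zero_Q)
    then show "\<forall>f\<in>polys_below k. galois_inner p l (enc f) (enc g) = 0" by blast
  next
    assume rad: "\<forall>f\<in>polys_below k. galois_inner p l (enc f) (enc g) = 0"
    have eq: "(\<Sum>z\<in>Z. c z * (poly f z * poly g z ^ ?Q)) +
      Polynomial.coeff f (k - 1) * Polynomial.coeff g (k - 1) ^ ?Q +
      (Polynomial.coeff f (k - 2) + \<zeta> * Polynomial.coeff f (k - 1)) *
      (Polynomial.coeff g (k - 2) + \<zeta> * Polynomial.coeff g (k - 1)) ^ ?Q = 0"
      if "f \<in> polys_below k" for f
    proof -
      have "galois_inner p l (enc f) (enc g) = 0" using rad that by blast
      then show ?thesis unfolding galois_inner_enc form[OF that g] .
    qed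
    have zero: "poly g z = 0" if z: "z \<in> Z" for z
    proof -
      \<comment> \<open>Isolates the point \<open>z\<close>; its degree is below
        \<open>k - 2\<close>, so the extra coordinates vanish.\<close>
      define f where "f = root_poly (Z - {z})"
      have "card Z > 0" using z assms(2) by (auto simp: card_gt_0_iff)
      then have deg: "Polynomial.degree f < k - 2"
        using z assms(2,3) by (simp add: f_def degree_root_poly)
      then have f: "f \<in> polys_below (k - 2)" by (simp add: polys_below_iff)
      then have tail: "Polynomial.coeff f (k - 1) = 0" "Polynomial.coeff f (k - 2) = 0"
        by (auto simp: polys_below_def)
      have "(\<Sum>y\<in>Z. c y * (poly f y * poly g y ^ ?Q)) =
          (\<Sum>y\<in>Z. if y = z then c z * (poly f z * poly g z ^ ?Q) else 0)"
        using assms(2) by (intro sum.cong) (auto simp: f_def poly_root_poly_eq_0_iff)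
      then have "c z * (poly f z * poly g z ^ ?Q) = 0"
        using eq[OF below_k[OF f]] tail z assms(2) by simp
      moreover have "poly f z \<noteq> 0" using assms(2) by (simp add: f_def poly_root_poly_eq_0_iff)
      ultimately show ?thesis using assms(4)[OF z] by simp
    qed
    then have sum0: "(\<Sum>z\<in>Z. c z * (poly f z * poly g z ^ ?Q)) = 0" for f
      by (simp add: zero_Q)
    \<comment> \<open>With the part on \<open>Z\<close> gone, \<open>x ^ (k - 2)\<close> tests only
      the last coordinate, after which \<open>x ^ (k - 1)\<close> tests the other one.\<close>
    have "Polynomial.monom 1 (k - 2) \<in> polys_below k" "Polynomial.monom 1 (k - 1) \<in> polys_below k"
      using k_ge by (auto simp: polys_below_def)
    note eq2 = eq[OF this(1)] eq[OF this(2)]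
    have "k - 1 \<noteq> k - 2" "k - 2 \<noteq> k - 1" using k_ge by auto
    then have "Polynomial.coeff g (k - 2) + \<zeta> * Polynomial.coeff g (k - 1) = 0"
      using eq2(1) sum0 by simp
    moreover from this have "Polynomial.coeff g (k - 1) = 0"
      using eq2(2) sum0 zero_Q by simp
    ultimately have tail: "Polynomial.coeff g (k - 1) = 0" "Polynomial.coeff g (k - 2) = 0"
      by simp_all
    have gb: "g \<in> polys_below (k - 2)"
      unfolding polys_below_def
    proof (intro CollectI allI impI)
      fix i assume "i \<ge> k - 2"
      then consider "i = k - 2" | "i = k - 1" | "i \<ge> k" by linarith
      then show "Polynomial.coeff g i = 0" using tail g by cases (auto simp: polys_below_def)
    qed
    obtain g' where g': "g = root_poly Z * g'"
      using root_poly_dvd[OF assms(2) zero] by (auto elim: dvdE)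
    have "g' \<in> polys_below h"
    proof (cases "g' = 0")
      case False
      then have "Polynomial.degree g = card Z + Polynomial.degree g'"
        unfolding g' by (subst degree_mult_eq) (auto simp: root_poly_neq_0 degree_root_poly)
      moreover have "Polynomial.degree g < k - 2"
        using gb k_ge by (simp add: polys_below_iff)
      ultimately show ?thesis using assms(3) by (simp add: polys_below_iff)
    qed (simp add: polys_below_def)
    then show "g \<in> (*) (root_poly Z) ` polys_below h" using g' by blast
  qed
  have "galois_hull p l (n + 2) C =
    enc ` {g \<in> polys_below k. \<forall>f\<in>polys_below k. galois_inner p l (enc f) (enc g) = 0}"
    using enc_carrier by (auto simp: galois_hull_def galois_dual_def GRL_eq)
  also have "{g \<in> polys_below k. \<forall>f\<in>polys_below k. galois_inner p l (enc f) (enc g) = 0} =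
    (*) (root_poly Z) ` polys_below h"
    using radical below below_k by blast
  finally have "galois_hull p l (n + 2) C = (\<lambda>g. enc (root_poly Z * g)) ` polys_below h"
    by (simp add: image_image)
  then show ?thesis
    using code_dim_enc_image[OF root_poly_neq_0, of h Z] below below_k by simp
qed

end

section \<open>Prescribing the hull dimension\<close>

context finite_field_tower
begin

text \<open>Write the weights as \<open>(p ^ l + 1)\<close>-th powers \<open>v\<^sub>i ^ (p ^ l + 1)\<close>, which is possible because the norm of
  the quadratic extension of \<open>K\<close> inside the ambient field is onto. Then the form vanishes except at
  the point \<open>0\<close> (when \<open>c \<noteq> 0\<close>), and multiplying \<open>r\<close> of the \<open>v\<^sub>i\<close> by \<open>\<omega>\<close> raises its rank by \<open>r\<close>.\<close>

lemma exists_hull_dim: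
  assumes l2: "2 * l dvd e" and q: "p ^ e > 4"
    and k: "3 \<le> k" "k \<le> n"
    and a: "a \<in> carrier_vec n" "distinct (list_of_vec a)"
    and w: "\<And>s. s \<in> set\<^sub>v a \<Longrightarrow> w s \<in> K \<and> w s \<noteq> 0"
    and c: "c = 0 \<or> 0 \<notin> set\<^sub>v a"
    and moments: "\<And>F. Polynomial.degree F \<le> (k - 1) * (p ^ l + 1) \<Longrightarrow>
      (\<Sum>s\<in>set\<^sub>v a. w s * poly F s) = c * poly F 0"
    and h: "h \<le> k - (if c = 0 then 2 else 3)"
  shows "\<exists>v\<in>carrier_vec n. (\<forall>i<n. v $ i \<noteq> 0) \<and>
    (\<forall>\<zeta>. code_dim (n + 2) (galois_hull p l (n + 2) (GRL k a v (A_mat \<zeta>))) = h)"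
proof -
  define Q where "Q = p ^ l"
  have Q: "Q \<ge> 2" using pl_gt_1 by (simp add: Q_def)
  have inj: "inj_on (($) a) {..<n}"
    using a by (rule inj_on_vec_index)
  have set_a: "set\<^sub>v a = ($) a ` {..<n}"
    using a by (auto simp: vec_set_def)
  obtain d where d: "e = 2 * l * d" using l2 by blast
  have "Q * Q = p ^ (2 * l)" by (simp add: Q_def mult_2 power_add)
  then have Qe: "p ^ e = (Q * Q) ^ d" by (simp add: d power_mult)
  have "d > 0" using q by (cases d) (auto simp: d)
  have "(Q - 1) * (Q + 1) = Q * Q - 1" using Q by (simp add: algebra_simps diff_mult_distrib)
  then have "(Q - 1) * (Q + 1) dvd CARD('a) - 1"
    using minus_1_dvd_power_minus_1[of "Q * Q" d] by (simp only: CARD_eq Qe)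
  then have Q1_dvd: "Q + 1 dvd (CARD('a) - 1) div (p ^ l - 1)"
    using dvd_CARD Q by (auto simp: Q_def dvd_div_iff_mult mult.commute)
  \<comment> \<open>Equality would give \<open>CARD('a) - 1 \<le> Q + 1\<close> although
    \<open>Q * Q \<le> CARD('a)\<close>, which leaves only \<open>Q = 2\<close> over four elements,
    the case excluded by \<open>p ^ e > 4\<close>.\<close>
  have "\<omega> ^ (Q + 1) \<noteq> 1"
  proof
    assume "\<omega> ^ (Q + 1) = 1"
    then have "CARD('a) - 1 \<le> Q + 1"
      using primitive_power_eq_1_iff[OF primitive, of "Q + 1"] by (auto dest: dvd_imp_le)
    moreover have "Q * Q \<le> CARD('a)"
      using \<open>d > 0\<close> Q self_le_power[of "Q * Q" d] by (simp add: CARD_eq Qe)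
    moreover have "CARD('a) > 4" using q by (simp add: CARD_eq)
    moreover have "Q \<ge> 3 \<Longrightarrow> Q * Q \<ge> 3 * Q" by (rule mult_le_mono1)
    ultimately show False using Q by linarith
  qed
  then have \<omega>1: "\<omega> ^ (Q + 1) - 1 \<noteq> 0" by simp
  have "\<exists>z. z \<noteq> 0 \<and> w (a $ i) = z ^ (Q + 1)" if "i < n" for i
  proof -
    have "w (a $ i) \<in> K" "w (a $ i) \<noteq> 0" using w that by (auto simp: set_a)
    from K_nonzero_is_power[OF this Q1_dvd] show ?thesis by blast
  qed
  then obtain u where u: "\<And>i. i < n \<Longrightarrow> u i \<noteq> 0 \<and> w (a $ i) = u i ^ (Q + 1)" by metis
  \<comment> \<open>The radical will have dimension \<open>k - 2 - card Z\<close>; for nonzero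
    \<open>c\<close> the point \<open>0\<close> already occupies one place of
    \<open>Z\<close>.\<close>
  define r where "r = k - (if c = 0 then 2 else 3) - h"
  define v where "v = vec n (\<lambda>i. if i < r then \<omega> * u i else u i)"
  have r: "r \<le> n" using k by (simp add: r_def)
  define Z0 where "Z0 = ($) a ` {..<r}"
  define Z where "Z = (if c = 0 then Z0 else insert 0 Z0)"
  have inj_r: "inj_on (($) a) {..<r}" using r by (intro inj_on_subset[OF inj]) auto
  have Z0: "finite Z0" "card Z0 = r" using inj_r by (auto simp: Z0_def card_image)
  have zero_notin: "c \<noteq> 0 \<Longrightarrow> 0 \<notin> Z0" using c r by (auto simp: Z0_def set_a)
  have Z: "finite Z" "card Z + 2 + h = k"
    using Z0 zero_notin h k by (auto simp: Z_def r_def)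
  \<comment> \<open>The moment identity removes \<open>w z\<close> once from the rescaled weight
    \<open>\<omega> ^ (Q + 1) * w z\<close>; at \<open>0\<close> its own right-hand side
    \<open>c\<close> remains.\<close>
  define cc where "cc z = (if c \<noteq> 0 \<and> z = 0 then c else (\<omega> ^ (Q + 1) - 1) * w z)" for z
  have cc: "cc z \<noteq> 0" if "z \<in> Z" for z
    using that w r \<omega>1 by (auto simp: Z_def cc_def Z0_def set_a split: if_splits)
  have v: "v \<in> carrier_vec n" "\<And>i. i < n \<Longrightarrow> v $ i \<noteq> 0"
    using u primitive_element_neq_0[OF primitive] by (auto simp: v_def)
  have "code_dim (n + 2) (galois_hull p l (n + 2) (GRL k a v (A_mat \<zeta>))) = h" for \<zeta>
  proof -
    interpret roth_lempel n k a v \<zeta>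
      by unfold_locales (use k a v in auto)
    show ?thesis
    proof (rule code_dim_galois_hull[OF _ Z cc])
      show "p ^ l > 0" using pl_gt_1 by linarith
      fix f g :: "'a poly" assume fg: "f \<in> polys_below k" "g \<in> polys_below k"
      define F where "F = f * g ^ Q"
      have pF: "poly F x = poly f x * poly g x ^ Q" for x by (simp add: F_def)
      have "Polynomial.degree F \<le> Polynomial.degree f + Polynomial.degree (g ^ Q)"
        unfolding F_def by (rule degree_mult_le)
      also have "\<dots> \<le> (k - 1) + (k - 1) * Q"
        using fg k mult_le_mono1[of "Polynomial.degree g" "k - 1" Q]
        by (intro add_mono order.trans[OF degree_power_le]) (auto simp: polys_below_iff)
      finally have "Polynomial.degree F \<le> (k - 1) * (p ^ l + 1)" by (simp add: Q_def)
      from moments[OF this] have mom: "(\<Sum>i<n. w (a $ i) * poly F (a $ i)) = c * poly F 0"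
        unfolding set_a by (simp add: sum.reindex[OF inj])
      have "(v $ i) ^ (Q + 1) * poly F (a $ i) = w (a $ i) * poly F (a $ i) +
          (if i < r then (\<omega> ^ (Q + 1) - 1) * w (a $ i) * poly F (a $ i) else 0)" if "i < n" for i
      proof -
        have "(v $ i) ^ (Q + 1) = (if i < r then \<omega> ^ (Q + 1) * w (a $ i) else w (a $ i))"
          using u[OF that] that by (simp only: v_def index_vec power_mult_distrib if_distrib[of "\<lambda>x. x ^ (Q + 1)"])
        then show ?thesis
          by (cases "i < r") (simp_all add: left_diff_distrib del: power_Suc)
      qed
      then have "(\<Sum>i<n. (v $ i) ^ (Q + 1) * poly F (a $ i)) = (\<Sum>i<n. w (a $ i) * poly F (a $ i)) +
          (\<Sum>i<n. if i < r then (\<omega> ^ (Q + 1) - 1) * w (a $ i) * poly F (a $ i) else 0)"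
        unfolding sum.distrib[symmetric] by (intro sum.cong) auto
      also have "(\<Sum>i<n. if i < r then (\<omega> ^ (Q + 1) - 1) * w (a $ i) * poly F (a $ i) else 0) =
          (\<Sum>i<r. (\<omega> ^ (Q + 1) - 1) * w (a $ i) * poly F (a $ i))"
        using r by (intro sum.mono_neutral_cong_right) auto
      also have "\<dots> = (\<Sum>z\<in>Z0. (\<omega> ^ (Q + 1) - 1) * w z * poly F z)"
        unfolding Z0_def by (simp add: sum.reindex[OF inj_r])
      also have "(\<Sum>i<n. w (a $ i) * poly F (a $ i)) + \<dots> = (\<Sum>z\<in>Z. cc z * poly F z)"
      proof (cases "c = 0")
        case True
        then show ?thesis by (simp only: mom Z_def cc_def) simp
      next
        case False
        have "(\<Sum>z\<in>Z0. (\<omega> ^ (Q + 1) - 1) * w z * poly F z) = (\<Sum>z\<in>Z0. cc z * poly F z)"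
          using zero_notin[OF False] by (intro sum.cong) (auto simp: cc_def)
        moreover have "(\<Sum>z\<in>Z. cc z * poly F z) = cc 0 * poly F 0 + (\<Sum>z\<in>Z0. cc z * poly F z)"
          using False zero_notin[OF False] Z0 by (simp add: Z_def)
        moreover have "cc 0 = c" using False by (simp add: cc_def)
        ultimately show ?thesis by (simp only: mom)
      qed
      finally show "(\<Sum>i<n. (v $ i) ^ (p ^ l + 1) * (poly f (a $ i) * poly g (a $ i) ^ (p ^ l))) =
          (\<Sum>z\<in>Z. cc z * (poly f z * poly g z ^ (p ^ l)))"
        by (simp only: pF Q_def)
    qed
  qed
  with v show ?thesis by blast
qed

text \<open>When \<open>0\<close> is one of the nodes but not a coordinate of the code, its term in the interpolation
  identity moves to the other side.\<close>

lemma
  assumes "finite S" "\<mu> \<noteq> 0" "\<And>s. s \<in> S \<Longrightarrow> \<mu> / node_prod S s \<in> K"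
  shows sum_node_weights: "Polynomial.degree F + 2 \<le> card S \<Longrightarrow> (\<Sum>s\<in>S. \<mu> / node_prod S s * poly F s) = 0"
    and sum_node_weights_remove_0: "0 \<in> S \<Longrightarrow> Polynomial.degree F + 2 \<le> card S \<Longrightarrow>
      (\<Sum>s\<in>S - {0}. \<mu> / node_prod S s * poly F s) = - (\<mu> / node_prod S 0) * poly F 0"
proof -
  show zero: "(\<Sum>s\<in>S. \<mu> / node_prod S s * poly F s) = 0" if "Polynomial.degree F + 2 \<le> card S"
  proof -
    have "(\<Sum>s\<in>S. \<mu> / node_prod S s * poly F s) = \<mu> * (\<Sum>s\<in>S. poly F s / node_prod S s)"
      by (simp add: sum_distrib_left)
    then show ?thesis using sum_over_node_prod_eq_0[OF assms(1), of F] that by simp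
  qed
  show "(\<Sum>s\<in>S - {0}. \<mu> / node_prod S s * poly F s) = - (\<mu> / node_prod S 0) * poly F 0"
    if "0 \<in> S" "Polynomial.degree F + 2 \<le> card S"
    using zero[OF that(2)] sum.remove[OF assms(1) that(1), of "\<lambda>s. \<mu> / node_prod S s * poly F s"]
    by (simp add: eq_neg_iff_add_eq_0 add.commute)
qed

lemma exists_hull_dim_evalset:
  assumes l2: "2 * l dvd e" and q: "p ^ e > 4"
    and a: "a \<in> carrier_vec n" "distinct (list_of_vec a)"
    and ev: "((evalset1 p l (set\<^sub>v a) \<or> evalset3 p l \<omega> (set\<^sub>v a) \<or> evalset5 p l \<omega> (set\<^sub>v a)) \<and>
            3 \<le> k \<and> k \<le> (n + p ^ l) div (p ^ l + 1) \<and> h \<le> k - 3)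
       \<or> ((evalset2 p l (set\<^sub>v a) \<or> evalset4 p l \<omega> (set\<^sub>v a) \<or> evalset6 p l \<omega> (set\<^sub>v a) \<or>
           evalset7 p e l (set\<^sub>v a) \<or> evalset8 p l (set\<^sub>v a) \<or> evalset10 p l (set\<^sub>v a)) \<and>
            3 \<le> k \<and> k \<le> (n + p ^ l - 1) div (p ^ l + 1) \<and> h \<le> k - 2)
       \<or> (\<exists>m. evalset9 p l m (set\<^sub>v a) \<and>
            ((3 \<le> k \<and> k \<le> (n + p ^ l) div (p ^ l + 1) \<and> h \<le> k - 3) \<or>
             (3 \<le> k \<and> k \<le> (n + p ^ l - m) div (p ^ l + 1) \<and> h \<le> k - 2)))"
  shows "3 \<le> k \<and> k \<le> n \<and> (\<exists>v \<in> carrier_vec n. (\<forall>i<n. v $ i \<noteq> 0) \<and>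
    (\<forall>\<zeta>. code_dim (n + 2) (galois_hull p l (n + 2) (GRL k a v (A_mat \<zeta>))) = h))"
proof -
  define S where "S = set\<^sub>v a"
  define D where "D = (k - 1) * (p ^ l + 1)"
  have inj: "inj_on (($) a) {..<n}"
    using a by (rule inj_on_vec_index)
  have "S = ($) a ` {..<n}" using a by (auto simp: vec_set_def S_def)
  then have card_S: "card S = n" "finite S" using inj by (auto simp: card_image)
  \<comment> \<open>Used with \<open>m = 0\<close> when \<open>0\<close> is an additional node, with
    \<open>m = 1\<close> when the nodes are exactly the coordinates, and with general
    \<open>m\<close> when the polynomial absorbs \<open>m - 1\<close> degrees.\<close>
  have bound: "D + 1 + m \<le> N" if "3 \<le> k" "k \<le> (N + p ^ l - m) div (p ^ l + 1)" for m N
  proof -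
    have "k * (p ^ l + 1) \<le> N + p ^ l - m"
      using that(2) by (metis div_times_less_eq_dividend le_trans mult_le_mono1)
    moreover have "k * (p ^ l + 1) = D + (p ^ l + 1)"
      using that(1) unfolding D_def by (cases k) auto
    ultimately show ?thesis by linarith
  qed
  have k_le: "k \<le> n" if "3 \<le> k" "D + 1 \<le> n"
  proof -
    have "k - 1 \<le> D" unfolding D_def by simp
    then show ?thesis using that by linarith
  qed
  note main = exists_hull_dim[OF l2 q _ _ a, of k, folded S_def D_def]
  \<comment> \<open>With \<open>0\<close> adjoined there are \<open>n + 1\<close> nodes, so
    \<open>D + 1 \<le> n\<close> suffices; the term at \<open>0\<close> moves across and gives a
    nonzero \<open>c\<close>.\<close>
  have typeA: ?thesis
    if pre: "power_preimage m S" and k: "3 \<le> k" "k \<le> (n + p ^ l) div (p ^ l + 1)" and h: "h \<le> k - 3" for m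
  proof -
    have nS: "0 \<notin> S" using pre by (rule zero_notin_power_preimage)
    define S' where "S' = insert 0 S"
    have S': "finite S'" "card S' = n + 1" "0 \<in> S'" "S' - {0} = S"
      using nS card_S by (auto simp: S'_def)
    have np: "1 / node_prod S' s \<in> K" if "s \<in> S'" for s
      using power_preimage_node_prod(2)[OF pre] that divide_in_K one_in_K unfolding S'_def by blast
    have kn: "D + 1 \<le> n" using bound[of n 0] k by simp
    show ?thesis
    proof (intro conjI main[of "\<lambda>s. 1 / node_prod S' s" "- (1 / node_prod S' 0)" h])
      show "(\<Sum>s\<in>S. 1 / node_prod S' s * poly F s) = - (1 / node_prod S' 0) * poly F 0"
        if "Polynomial.degree F \<le> D" for F
        using sum_node_weights_remove_0[OF S'(1) _ np S'(3), of F] that kn S' by simp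
    qed (use k kn k_le h nS np S' node_prod_neq_0[OF S'(1)] in \<open>auto simp: S'_def[symmetric]\<close>)
  qed
  have typeB: ?thesis
    if np: "\<mu> \<noteq> 0" "\<And>s. s \<in> S \<Longrightarrow> \<mu> / node_prod S s \<in> K"
      and k: "3 \<le> k" "k \<le> (n + p ^ l - 1) div (p ^ l + 1)" and h: "h \<le> k - 2" for \<mu>
  proof -
    have kn: "D + 2 \<le> n" using bound[of n 1] k by simp
    show ?thesis
    proof (intro conjI main[of "\<lambda>s. \<mu> / node_prod S s" 0 h])
      show "(\<Sum>s\<in>S. \<mu> / node_prod S s * poly F s) = 0 * poly F 0"
        if "Polynomial.degree F \<le> D" for F
        using sum_node_weights[OF card_S(2) np, of F] that kn card_S by simp
    qed (use k kn k_le h np node_prod_neq_0[OF card_S(2)] in auto)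
  qed
  \<comment> \<open>Here \<open>0\<close> is a node and a coordinate at the same time, so no term is
    left over.\<close>
  have typeB': ?thesis
    if pre: "power_preimage m S'" and S: "S = insert 0 S'"
      and k: "3 \<le> k" "k \<le> (n + p ^ l - 1) div (p ^ l + 1)" and h: "h \<le> k - 2" for m S'
  proof (rule typeB[of 1])
    show "1 / node_prod S s \<in> K" if "s \<in> S" for s
      using power_preimage_node_prod(2)[OF pre] that divide_in_K one_in_K unfolding S by blast
  qed (use k h in auto)
  have type9: ?thesis
    if pre: "power_preimage m S" and k: "3 \<le> k" "k \<le> (n + p ^ l - m) div (p ^ l + 1)" and h: "h \<le> k - 2" for m
  proof -
    have nS: "0 \<notin> S" using pre by (rule zero_notin_power_preimage)
    have m: "m > 0" using pre by (rule power_preimage_pos)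
    have kn: "D + 1 + m \<le> n" using bound k by simp
    show ?thesis
    proof (intro conjI main[of "\<lambda>s. s ^ (m - 1) / node_prod S s" 0 h])
      show "(\<Sum>s\<in>S. s ^ (m - 1) / node_prod S s * poly F s) = 0 * poly F 0"
        if deg: "Polynomial.degree F \<le> D" for F
      proof -
        \<comment> \<open>The factor \<open>s ^ (m - 1)\<close> of the weight is read as part of the
          polynomial, so that plain interpolation applies.\<close>
        define F' where "F' = Polynomial.monom 1 (m - 1) * F"
        have "Polynomial.degree F' \<le> (m - 1) + Polynomial.degree F"
          unfolding F'_def using degree_mult_le[of "Polynomial.monom 1 (m - 1)" F]
          by (simp add: degree_monom_eq)
        then have "Polynomial.degree F' + 1 < card S" using deg kn m card_S by linarith
        then have "(\<Sum>s\<in>S. poly F' s / node_prod S s) = 0"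
          by (rule sum_over_node_prod_eq_0[OF card_S(2)])
        then show ?thesis by (simp add: F'_def poly_monom)
      qed
    qed (use k kn k_le h nS power_preimage_node_prod(1)[OF pre] node_prod_neq_0[OF card_S(2)] in auto)
  qed
  have e_pos: "e > 0" using q by (cases e) auto
  from ev[folded S_def] show ?thesis
  proof (elim disjE conjE exE)
    assume ev': "evalset1 p l S" and k: "3 \<le> k" "k \<le> (n + p ^ l) div (p ^ l + 1)" "h \<le> k - 3"
    from ev' show ?thesis by (rule evalset1_power_preimage) (rule typeA[OF _ k])
  next
    assume ev': "evalset3 p l \<omega> S" and k: "3 \<le> k" "k \<le> (n + p ^ l) div (p ^ l + 1)" "h \<le> k - 3"
    from ev' show ?thesis by (rule evalset3_power_preimage) (rule typeA[OF _ k])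
  next
    assume ev': "evalset5 p l \<omega> S" and k: "3 \<le> k" "k \<le> (n + p ^ l) div (p ^ l + 1)" "h \<le> k - 3"
    from ev' show ?thesis by (rule evalset5_power_preimage) (rule typeA[OF _ k])
  next
    assume ev': "evalset2 p l S" and k: "3 \<le> k" "k \<le> (n + p ^ l - 1) div (p ^ l + 1)" "h \<le> k - 2"
    from ev' obtain S' where pre: "evalset1 p l S'" and S': "S = insert 0 S'"
      unfolding evalset2_def by blast
    from pre show ?thesis by (rule evalset1_power_preimage) (rule typeB'[OF _ S' k])
  next
    assume ev': "evalset4 p l \<omega> S" and k: "3 \<le> k" "k \<le> (n + p ^ l - 1) div (p ^ l + 1)" "h \<le> k - 2"
    from ev' obtain S' where pre: "evalset3 p l \<omega> S'" and S': "S = insert 0 S'"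
      unfolding evalset4_def by blast
    from pre show ?thesis by (rule evalset3_power_preimage) (rule typeB'[OF _ S' k])
  next
    assume ev': "evalset6 p l \<omega> S" and k: "3 \<le> k" "k \<le> (n + p ^ l - 1) div (p ^ l + 1)" "h \<le> k - 2"
    from ev' obtain S' where pre: "evalset5 p l \<omega> S'" and S': "S = insert 0 S'"
      unfolding evalset6_def by blast
    from pre show ?thesis by (rule evalset5_power_preimage) (rule typeB'[OF _ S' k])
  next
    assume ev': "evalset7 p e l S" and k: "3 \<le> k" "k \<le> (n + p ^ l - 1) div (p ^ l + 1)" "h \<le> k - 2"
    from ev' show ?thesis using evalset7_node_prod[OF e_pos] by (intro typeB[of 1, OF _ _ k]) simp_all
  next
    assume ev': "evalset8 p l S" and k: "3 \<le> k" "k \<le> (n + p ^ l - 1) div (p ^ l + 1)" "h \<le> k - 2"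
    from ev' show ?thesis by (rule evalset8_node_prod) (rule typeB[OF _ _ k])
  next
    assume ev': "evalset10 p l S" and k: "3 \<le> k" "k \<le> (n + p ^ l - 1) div (p ^ l + 1)" "h \<le> k - 2"
    from ev' show ?thesis by (rule evalset10_power_preimage) (rule typeB'[OF _ _ k])
  next
    fix m assume ev': "evalset9 p l m S" and k: "3 \<le> k" "k \<le> (n + p ^ l) div (p ^ l + 1)" "h \<le> k - 3"
    from ev' show ?thesis by (intro typeA[OF _ k] evalset9_power_preimage)
  next
    fix m assume ev': "evalset9 p l m S" and k: "3 \<le> k" "k \<le> (n + p ^ l - m) div (p ^ l + 1)" "h \<le> k - 2"
    from ev' show ?thesis by (intro type9[OF _ k] evalset9_power_preimage)
  qed
qed

end

theorem mainTheorem14: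
  fixes p e l n k h :: nat
    and \<omega> :: "'a :: {field, finite}"
    and a :: "'a vec"
  assumes "prime p" and "CARD('a) = p ^ e" and "p ^ e > 4"
    and "0 < l" and "2 * l dvd e"
    and "primitive_element \<omega>"
    and "a \<in> carrier_vec n" and "distinct (list_of_vec a)"
    and "((evalset1 p l (set\<^sub>v a) \<or> evalset3 p l \<omega> (set\<^sub>v a) \<or> evalset5 p l \<omega> (set\<^sub>v a)) \<and>
            3 \<le> k \<and> k \<le> (n + p ^ l) div (p ^ l + 1) \<and> h \<le> k - 3)
       \<or> ((evalset2 p l (set\<^sub>v a) \<or> evalset4 p l \<omega> (set\<^sub>v a) \<or> evalset6 p l \<omega> (set\<^sub>v a) \<or>
           evalset7 p e l (set\<^sub>v a) \<or> evalset8 p l (set\<^sub>v a) \<or> evalset10 p l (set\<^sub>v a)) \<and>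
            3 \<le> k \<and> k \<le> (n + p ^ l - 1) div (p ^ l + 1) \<and> h \<le> k - 2)
       \<or> (\<exists>m. evalset9 p l m (set\<^sub>v a) \<and>
            ((3 \<le> k \<and> k \<le> (n + p ^ l) div (p ^ l + 1) \<and> h \<le> k - 3) \<or>
             (3 \<le> k \<and> k \<le> (n + p ^ l - m) div (p ^ l + 1) \<and> h \<le> k - 2)))"
  shows "(\<exists>C :: 'a vec set. GRL_code n 2 k C \<and> linear_code (n + 2) k (n - k + 2) C \<and>
            NMDS (n + 2) C \<and> code_dim (n + 2) (galois_hull p l (n + 2) C) = h)
       \<and> (Delta (k - 1) a \<noteq> UNIV \<longrightarrow>
          (\<exists>C :: 'a vec set. GRL_code n 2 k C \<and> linear_code (n + 2) k (n - k + 3) C \<and>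
            MDS (n + 2) C \<and> code_dim (n + 2) (galois_hull p l (n + 2) C) = h))
       \<and> (\<forall>\<zeta> \<in> Delta (k - 1) a. \<exists>v C. GRL_params n 2 k a v (A_mat \<zeta>) \<and>
            C = GRL k a v (A_mat \<zeta>) \<and> linear_code (n + 2) k (n - k + 2) C \<and>
            NMDS (n + 2) C \<and> code_dim (n + 2) (galois_hull p l (n + 2) C) = h)
       \<and> (\<forall>\<zeta> \<in> UNIV - Delta (k - 1) a. \<exists>v C. GRL_params n 2 k a v (A_mat \<zeta>) \<and>
            C = GRL k a v (A_mat \<zeta>) \<and> linear_code (n + 2) k (n - k + 3) C \<and>
            MDS (n + 2) C \<and> code_dim (n + 2) (galois_hull p l (n + 2) C) = h)"
proof -
  interpret finite_field_tower p e l \<omega>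
    using assms by unfold_locales (auto dest: dvd_mult_right)
  obtain v where k: "3 \<le> k" "k \<le> n" and v: "v \<in> carrier_vec n" "\<And>i. i < n \<Longrightarrow> v $ i \<noteq> 0"
    and hull: "\<And>\<zeta>. code_dim (n + 2) (galois_hull p l (n + 2) (GRL k a v (A_mat \<zeta>))) = h"
    using exists_hull_dim_evalset[OF assms(5,3,7,8,9)] by blast
  have rl: "roth_lempel n k a v" by unfold_locales (use k v assms(7,8) in auto)
  have nmds: "GRL_params n 2 k a v (A_mat \<zeta>) \<and> linear_code (n + 2) k (n - k + 2) (GRL k a v (A_mat \<zeta>)) \<and>
      NMDS (n + 2) (GRL k a v (A_mat \<zeta>))" if "\<zeta> \<in> Delta (k - 1) a" for \<zeta>
    using roth_lempel.GRL_params[OF rl] roth_lempel.linear_code_C[OF rl, of \<zeta>]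
      roth_lempel.NMDS_C[OF rl that] that by simp
  have mds: "GRL_params n 2 k a v (A_mat \<zeta>) \<and> linear_code (n + 2) k (n - k + 3) (GRL k a v (A_mat \<zeta>)) \<and>
      MDS (n + 2) (GRL k a v (A_mat \<zeta>))" if "\<zeta> \<notin> Delta (k - 1) a" for \<zeta>
    using roth_lempel.GRL_params[OF rl] roth_lempel.linear_code_C[OF rl, of \<zeta>]
      roth_lempel.MDS_C[OF rl that] that by simp
  \<comment> \<open>Subset sums of size \<open>k - 1\<close> exist, so an NMDS code exists
    unconditionally.\<close>
  have "(\<Sum>i<k - 1. a $ i) \<in> Delta (k - 1) a"
    using k by (intro roth_lempel.Delta_I[OF rl]) auto
  then show ?thesis
    using nmds mds hull unfolding GRL_code_def by blast
qed

end
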